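(* Let $x\in X$ be such that $\mathfrak a(x)=\mathrm{cl}(x)$. Assume that $|\mathfrak a(x)|=r$ and $|[x]|=s$. Then $s\le r$ and $$\mathrm{St}_x^{\mathrm v}\cong \mathrm{GL}(s,\mathbb Z)\ltimes_\theta \mathcal M(s,r-s),$$ where, for $A\in \mathrm{GL}(s,\mathbb Z)$ and $B\in\mathcal M(s,r-s)$, the automorphism $A\theta$ maps $B$ to $A^{-1}B\in\mathcal M(s,r-s)$.
   Context: Let $\Gamma$ be a finite simple graph with vertex set $X$, and let $\mathbb G=\mathbb G_\Gamma$ be the partially commutative group (right-angled Artin group) generated by $X$ with relations $[x,y]=1$ for each edge $\{x,y\}$ of $\Gamma$. For $Y\subseteq X$, $\mathbb G(Y)$ is the subgroup generated by $Y$. Automorphisms act on the right. For $x\in X$: $\mathrm{lk}(x)$ is the set of vertices adjacent to $x$, $\mathrm{st}(x)=\mathrm{lk}(x)\cup\{x\}$. Write $x\sim y$ if $\mathrm{st}(x)=\mathrm{st}(y)$ or $\mathrm{lk}(x)=\mathrm{lk}(y)$; this is an equivalence relation with classes $[x]$. Put $\mathfrak a(x)=\bigcap_{y\in \mathrm{lk}(x)}\mathrm{st}(y)$ (equal to $X$ if $\mathrm{lk}(x)=\emptyset$), $\mathrm{cl}(x)=\bigcap_{y\in \mathrm{st}(x)}\mathrm{st}(y)$, and $\mathcal K=\{\mathfrak a(x): x\in X\}$. Define $\mathrm{St}(\mathcal K)=\{\phi\in\mathrm{Aut}(\mathbb G): \mathbb G(Y)\phi=\mathbb G(Y)\text{ for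 all }Y\in\mathcal K\}$ and $\mathrm{St}_x^{\mathrm v}=\{\phi\in \mathrm{St}(\mathcal K): y\phi=y\ \forall y\in X\setminus [x]\}$. $\mathcal M(a,b)$ is the additive group of $a\times b$ integer matrices (trivial if $b=0$). In $H\ltimes_\theta N$ the normal factor is $N$, and $h^{-1}nh=n(h\theta)$ for $h\in H$, $n\in N$ (maps on the right). *)

theory Defs
  imports
    "HOL-Algebra.Bij"
    "HOL-Algebra.Generated_Groups"
    "Graph_Theory.Pair_Digraph"
    "Jordan_Normal_Form.Matrix"
begin

section \<open>Groups given by generators and relators\<close>

text \<open>A word over \<open>X\<close> is a list of letters \<open>(x, True)\<close>, standing for \<open>x\<close>, and
  \<open>(x, False)\<close>, standing for the inverse of \<open>x\<close>.\<close>

definition words :: "'a set \<Rightarrow> ('a \<times> bool) list set" where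
  "words X = lists (X \<times> UNIV)"

inductive_set word_rel :: "'a set \<Rightarrow> ('a \<times> bool) list set \<Rightarrow> (('a \<times> bool) list) rel"
  for X :: "'a set" and R :: "('a \<times> bool) list set" where
  refl: "w \<in> words X \<Longrightarrow> (w, w) \<in> word_rel X R"
| sym: "(v, w) \<in> word_rel X R \<Longrightarrow> (w, v) \<in> word_rel X R"
| trans: "(u, v) \<in> word_rel X R \<Longrightarrow> (v, w) \<in> word_rel X R \<Longrightarrow> (u, w) \<in> word_rel X R"
| cancel: "u \<in> words X \<Longrightarrow> v \<in> words X \<Longrightarrow> x \<in> X \<Longrightarrow>
    (u @ [(x, b), (x, \<not> b)] @ v, u @ v) \<in> word_rel X R"
| relator: "u \<in> words X \<Longrightarrow> v \<in> words X \<Longrightarrow> r \<in> R \<Longrightarrow> r \<in> words X \<Longrightarrow>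
    (u @ r @ v, u @ v) \<in> word_rel X R"

definition presented_group ::
  "'a set \<Rightarrow> ('a \<times> bool) list set \<Rightarrow> ('a \<times> bool) list set monoid" where
  "presented_group X R =
    \<lparr> carrier = words X // word_rel X R,
      monoid.mult = (\<lambda>A B. \<Union>u\<in>A. \<Union>v\<in>B. word_rel X R `` {u @ v}),
      one = word_rel X R `` {[]} \<rparr>"

lemma words_simps [simp]:
  "[] \<in> words X"
  "p # w \<in> words X \<longleftrightarrow> fst p \<in> X \<and> w \<in> words X"
  "u @ v \<in> words X \<longleftrightarrow> u \<in> words X \<and> v \<in> words X"
  by (auto simp: words_def mem_Times_iff)

lemma word_rel_in_words: "(u, v) \<in> word_rel X R \<Longrightarrow> u \<in> words X \<and> v \<in> words X"
  by (induction rule: word_rel.induct) auto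

lemma equiv_word_rel: "equiv (words X) (word_rel X R)"
  by (rule equivI) (auto simp: refl_on_def dest: word_rel_in_words
      intro: word_rel.refl word_rel.sym word_rel.trans intro!: symI transI)

lemma word_rel_context:
  "(u, v) \<in> word_rel X R \<Longrightarrow> p \<in> words X \<Longrightarrow> q \<in> words X \<Longrightarrow> (p @ u @ q, p @ v @ q) \<in> word_rel X R"
proof (induction rule: word_rel.induct)
  case (cancel u v x b)
  then show ?case using word_rel.cancel[of "p @ u" X "v @ q" x b R] by simp
next
  case (relator u v r)
  then show ?case using word_rel.relator[of "p @ u" X "v @ q" r R] by simp
qed (auto intro: word_rel.refl word_rel.sym word_rel.trans)

lemma word_rel_append:
  assumes "(u, u') \<in> word_rel X R" "(v, v') \<in> word_rel X R"
  shows "(u @ v, u' @ v') \<in> word_rel X R"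
proof -
  have "(u @ v, u' @ v) \<in> word_rel X R"
    using word_rel_context[OF assms(1), of "[]" v] word_rel_in_words[OF assms(2)] by simp
  moreover have "(u' @ v, u' @ v') \<in> word_rel X R"
    using word_rel_context[OF assms(2), of u' "[]"] word_rel_in_words[OF assms(1)] by simp
  ultimately show ?thesis by (rule word_rel.trans)
qed

lemma presented_group_mult:
  assumes "u \<in> words X" "v \<in> words X"
  shows "(word_rel X R `` {u}) \<otimes>\<^bsub>presented_group X R\<^esub> (word_rel X R `` {v}) = word_rel X R `` {u @ v}"
proof -
  have "(\<lambda>u v. word_rel X R `` {u @ v}) respects2 (word_rel X R)"
    by (intro congruent2I' equiv_class_eq[OF equiv_word_rel] word_rel_append)
  then show ?thesis
    using UN_equiv_class2[OF equiv_word_rel equiv_word_rel _ assms] by (simp add: presented_group_def)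
qed

lemma presented_group_carrierE:
  assumes "a \<in> carrier (presented_group X R)"
  obtains u where "u \<in> words X" "a = word_rel X R `` {u}"
  using assms by (auto simp: presented_group_def elim: quotientE)

lemma word_rel_left_inverse:
  "w \<in> words X \<Longrightarrow> \<exists>v \<in> words X. (v @ w, []) \<in> word_rel X R"
proof (induction w)
  case Nil
  then show ?case by (auto intro!: bexI[of _ "[]"] word_rel.refl)
next
  case (Cons p w)
  obtain x b where p: "p = (x, b)" by fastforce
  from Cons obtain v where v: "v \<in> words X" "(v @ w, []) \<in> word_rel X R" by auto
  have "(v @ [(x, \<not> b), (x, \<not> \<not> b)] @ w, v @ w) \<in> word_rel X R"
    using Cons.prems v(1) p by (intro word_rel.cancel) auto
  then have "((v @ [(x, \<not> b)]) @ p # w, []) \<in> word_rel X R"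
    using v(2) p by (auto intro: word_rel.trans)
  moreover have "v @ [(x, \<not> b)] \<in> words X" using v(1) Cons.prems p by simp
  ultimately show ?case by blast
qed

theorem group_presented_group: "group (presented_group X R)"
proof (rule groupI)
  fix a b assume "a \<in> carrier (presented_group X R)" "b \<in> carrier (presented_group X R)"
  then show "a \<otimes>\<^bsub>presented_group X R\<^esub> b \<in> carrier (presented_group X R)"
    by (auto elim!: presented_group_carrierE simp: presented_group_mult)
      (simp add: presented_group_def quotientI)
next
  show "\<one>\<^bsub>presented_group X R\<^esub> \<in> carrier (presented_group X R)"
    by (simp add: presented_group_def quotientI)
next
  fix a b c
  assume "a \<in> carrier (presented_group X R)" "b \<in> carrier (presented_group X R)"
    "c \<in> carrier (presented_group X R)"
  then show "a \<otimes>\<^bsub>presented_group X R\<^esub> b \<otimes>\<^bsub>presented_group X R\<^esub> c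
    = a \<otimes>\<^bsub>presented_group X R\<^esub> (b \<otimes>\<^bsub>presented_group X R\<^esub> c)"
    by (auto elim!: presented_group_carrierE simp: presented_group_mult)
next
  fix a assume "a \<in> carrier (presented_group X R)"
  then obtain u where u: "u \<in> words X" "a = word_rel X R `` {u}" by (rule presented_group_carrierE)
  have one: "\<one>\<^bsub>presented_group X R\<^esub> = word_rel X R `` {[]}" by (simp add: presented_group_def)
  show "\<one>\<^bsub>presented_group X R\<^esub> \<otimes>\<^bsub>presented_group X R\<^esub> a = a"
    using presented_group_mult[of "[]" X u R] u by (simp add: one)
  obtain v where v: "v \<in> words X" "(v @ u, []) \<in> word_rel X R"
    using word_rel_left_inverse[OF u(1)] by blast
  then have "(word_rel X R `` {v}) \<otimes>\<^bsub>presented_group X R\<^esub> a = \<one>\<^bsub>presented_group X R\<^esub>"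
    using u v by (simp add: one presented_group_mult equiv_class_eq[OF equiv_word_rel])
  moreover have "word_rel X R `` {v} \<in> carrier (presented_group X R)"
    using v by (simp add: presented_group_def quotientI)
  ultimately show "\<exists>b\<in>carrier (presented_group X R).
    b \<otimes>\<^bsub>presented_group X R\<^esub> a = \<one>\<^bsub>presented_group X R\<^esub>" by blast
qed


section \<open>Semidirect products and automorphism groups with maps on the right\<close>

text \<open>The pair \<open>(h, n)\<close> stands for the product \<open>h n\<close>, and \<open>\<theta> h\<close> is conjugation
  \<open>n \<mapsto> h\<inverse> n h\<close>, so that \<open>h\<^sub>1 n\<^sub>1 h\<^sub>2 n\<^sub>2 = (h\<^sub>1 h\<^sub>2) (h\<^sub>2\<inverse> n\<^sub>1 h\<^sub>2) n\<^sub>2\<close>.\<close>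

definition semidirect ::
  "('h, 'c) monoid_scheme \<Rightarrow> ('h \<Rightarrow> 'n \<Rightarrow> 'n) \<Rightarrow> ('n, 'd) monoid_scheme \<Rightarrow> ('h \<times> 'n) monoid" where
  "semidirect H \<theta> N =
    \<lparr> carrier = carrier H \<times> carrier N,
      monoid.mult = (\<lambda>(h\<^sub>1, n\<^sub>1) (h\<^sub>2, n\<^sub>2). (h\<^sub>1 \<otimes>\<^bsub>H\<^esub> h\<^sub>2, \<theta> h\<^sub>2 n\<^sub>1 \<otimes>\<^bsub>N\<^esub> n\<^sub>2)),
      one = (\<one>\<^bsub>H\<^esub>, \<one>\<^bsub>N\<^esub>) \<rparr>"

text \<open>Automorphisms act on the right: the product of \<open>\<phi>\<close> and \<open>\<psi>\<close> is \<open>\<phi>\<close> followed by \<open>\<psi>\<close>,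
  the opposite of the product in \<^const>\<open>AutoGroup\<close>.\<close>

definition right_Aut :: "('a, 'c) monoid_scheme \<Rightarrow> ('a \<Rightarrow> 'a) monoid" where
  "right_Aut G = (AutoGroup G) \<lparr> monoid.mult := (\<lambda>\<phi> \<psi>. \<psi> \<otimes>\<^bsub>AutoGroup G\<^esub> \<phi>) \<rparr>"

lemma right_Aut_simps:
  "carrier (right_Aut G) = auto G"
  "\<one>\<^bsub>right_Aut G\<^esub> = (\<lambda>x\<in>carrier G. x)"
  "\<phi> \<in> auto G \<Longrightarrow> \<psi> \<in> auto G \<Longrightarrow> \<phi> \<otimes>\<^bsub>right_Aut G\<^esub> \<psi> = compose (carrier G) \<psi> \<phi>"
  by (simp_all add: right_Aut_def AutoGroup_def BijGroup_def auto_def)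

lemma (in group) group_right_Aut: "group (right_Aut G)"
proof -
  interpret A: group "AutoGroup G" by (rule AutoGroup)
  show ?thesis
  proof (rule groupI)
    fix \<phi> assume "\<phi> \<in> carrier (right_Aut G)"
    then have "\<phi> \<in> carrier (AutoGroup G)" by (simp add: right_Aut_def)
    then show "\<exists>\<psi>\<in>carrier (right_Aut G). \<psi> \<otimes>\<^bsub>right_Aut G\<^esub> \<phi> = \<one>\<^bsub>right_Aut G\<^esub>"
      by (intro bexI[of _ "inv\<^bsub>AutoGroup G\<^esub> \<phi>"]) (auto simp: right_Aut_def)
  qed (auto simp: right_Aut_def A.m_assoc)
qed

theorem group_semidirect:
  assumes H: "group H" and N: "group N" and \<theta>: "\<theta> \<in> hom H (right_Aut N)"
  shows "group (semidirect H \<theta> N)"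
proof -
  interpret H: group H by fact
  interpret N: group N by fact
  have mem: "\<theta> h \<in> auto N" if "h \<in> carrier H" for h
    using \<theta> that by (auto simp: hom_def right_Aut_simps)
  have clos: "\<theta> h n \<in> carrier N" if "h \<in> carrier H" "n \<in> carrier N" for h n
    using mem[OF that(1)] that(2) by (auto simp: auto_def hom_def)
  have mult: "\<theta> h (m \<otimes>\<^bsub>N\<^esub> n) = \<theta> h m \<otimes>\<^bsub>N\<^esub> \<theta> h n"
    if "h \<in> carrier H" "m \<in> carrier N" "n \<in> carrier N" for h m n
    using mem[OF that(1)] that(2,3) by (auto simp: auto_def hom_def)
  have comp: "\<theta> (g \<otimes>\<^bsub>H\<^esub> h) n = \<theta> h (\<theta> g n)"
    if "g \<in> carrier H" "h \<in> carrier H" "n \<in> carrier N" for g h n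
    using \<theta> that mem by (auto simp: hom_def right_Aut_simps compose_eq)
  interpret \<theta>: group_hom H "right_Aut N" \<theta>
    using \<theta> by (simp add: group_hom_def group_hom_axioms_def H N.group_right_Aut)
  have one: "\<theta> \<one>\<^bsub>H\<^esub> n = n" if "n \<in> carrier N" for n
    using \<theta>.hom_one that by (simp add: right_Aut_simps)
  show ?thesis
  proof (rule groupI)
    fix a assume "a \<in> carrier (semidirect H \<theta> N)"
    then obtain h n where a: "a = (h, n)" "h \<in> carrier H" "n \<in> carrier N"
      by (auto simp: semidirect_def)
    show "\<one>\<^bsub>semidirect H \<theta> N\<^esub> \<otimes>\<^bsub>semidirect H \<theta> N\<^esub> a = a"
      using a group_hom.hom_one[of N N "\<theta> h"] mem[of h]
      by (simp add: semidirect_def auto_def group_hom_def group_hom_axioms_def N)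
    have "\<theta> h (\<theta> (inv\<^bsub>H\<^esub> h) (inv\<^bsub>N\<^esub> n)) \<otimes>\<^bsub>N\<^esub> n = \<one>\<^bsub>N\<^esub>"
      using a comp[of "inv\<^bsub>H\<^esub> h" h "inv\<^bsub>N\<^esub> n"] one[of "inv\<^bsub>N\<^esub> n"]
      by (simp del: \<theta>.hom_inv)
    then show "\<exists>b\<in>carrier (semidirect H \<theta> N).
      b \<otimes>\<^bsub>semidirect H \<theta> N\<^esub> a = \<one>\<^bsub>semidirect H \<theta> N\<^esub>"
      using a clos by (intro bexI[of _ "(inv\<^bsub>H\<^esub> h, \<theta> (inv\<^bsub>H\<^esub> h) (inv\<^bsub>N\<^esub> n))"])
        (auto simp: semidirect_def simp del: \<theta>.hom_inv)
  qed (auto simp: semidirect_def clos mult comp H.m_assoc N.m_assoc simp del: \<theta>.hom_mult)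
qed

lemma semidirect_conjugation:
  assumes H: "group H" and N: "group N" and \<theta>: "\<theta> \<in> hom H (right_Aut N)"
    and h: "h \<in> carrier H" and n: "n \<in> carrier N"
  shows "inv\<^bsub>semidirect H \<theta> N\<^esub> (h, \<one>\<^bsub>N\<^esub>) \<otimes>\<^bsub>semidirect H \<theta> N\<^esub> (\<one>\<^bsub>H\<^esub>, n)
    \<otimes>\<^bsub>semidirect H \<theta> N\<^esub> (h, \<one>\<^bsub>N\<^esub>) = (\<one>\<^bsub>H\<^esub>, \<theta> h n)"
proof -
  interpret H: group H by fact
  interpret N: group N by fact
  interpret S: group "semidirect H \<theta> N" by (rule group_semidirect[OF H N \<theta>])
  have A: "\<theta> h \<in> auto N" using \<theta> h by (auto simp: hom_def right_Aut_simps)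
  then have c: "\<theta> h n \<in> carrier N" using n by (auto simp: auto_def hom_def)
  have o: "\<theta> h \<one>\<^bsub>N\<^esub> = \<one>\<^bsub>N\<^esub>"
    using A group_hom.hom_one[of N N "\<theta> h"] by (simp add: auto_def group_hom_def group_hom_axioms_def N)
  have car: "(h, \<one>\<^bsub>N\<^esub>) \<in> carrier (semidirect H \<theta> N)" "(\<one>\<^bsub>H\<^esub>, n) \<in> carrier (semidirect H \<theta> N)"
    "(\<one>\<^bsub>H\<^esub>, \<theta> h n) \<in> carrier (semidirect H \<theta> N)"
    using h n c by (auto simp: semidirect_def)
  have "(\<one>\<^bsub>H\<^esub>, n) \<otimes>\<^bsub>semidirect H \<theta> N\<^esub> (h, \<one>\<^bsub>N\<^esub>) = (h, \<one>\<^bsub>N\<^esub>) \<otimes>\<^bsub>semidirect H \<theta> N\<^esub> (\<one>\<^bsub>H\<^esub>, \<theta> h n)"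
    using h n c o group_hom.hom_one[of H "right_Aut N" \<theta>] H N.group_right_Aut \<theta>
    by (simp add: semidirect_def group_hom_def group_hom_axioms_def right_Aut_simps)
  then show ?thesis using car by (simp add: S.m_assoc S.inv_solve_left')
qed


section \<open>Partially commutative groups\<close>

definition lk :: "'a pair_pre_digraph \<Rightarrow> 'a \<Rightarrow> 'a set" where
  "lk \<Gamma> x = {y. (x, y) \<in> parcs \<Gamma>}"

definition st :: "'a pair_pre_digraph \<Rightarrow> 'a \<Rightarrow> 'a set" where
  "st \<Gamma> x = lk \<Gamma> x \<union> {x}"

definition nbh_class :: "'a pair_pre_digraph \<Rightarrow> 'a \<Rightarrow> 'a set" where
  "nbh_class \<Gamma> x = {y \<in> pverts \<Gamma>. st \<Gamma> x = st \<Gamma> y \<or> lk \<Gamma> x = lk \<Gamma> y}"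

text \<open>Intersecting with the vertex set gives the intended value for an empty link.\<close>

definition adm :: "'a pair_pre_digraph \<Rightarrow> 'a \<Rightarrow> 'a set" where
  "adm \<Gamma> x = pverts \<Gamma> \<inter> (\<Inter>y\<in>lk \<Gamma> x. st \<Gamma> y)"

definition cl :: "'a pair_pre_digraph \<Rightarrow> 'a \<Rightarrow> 'a set" where
  "cl \<Gamma> x = (\<Inter>y\<in>st \<Gamma> x. st \<Gamma> y)"

definition commutator_word :: "'a \<Rightarrow> 'a \<Rightarrow> ('a \<times> bool) list" where
  "commutator_word x y = [(x, False), (y, False), (x, True), (y, True)]"

definition raag :: "'a pair_pre_digraph \<Rightarrow> ('a \<times> bool) list set monoid" where
  "raag \<Gamma> = presented_group (pverts \<Gamma>) {commutator_word x y | x y. (x, y) \<in> parcs \<Gamma>}"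

definition gen :: "'a pair_pre_digraph \<Rightarrow> 'a \<Rightarrow> ('a \<times> bool) list set" where
  "gen \<Gamma> x =
    word_rel (pverts \<Gamma>) {commutator_word y z | y z. (y, z) \<in> parcs \<Gamma>} `` {[(x, True)]}"

definition raag_sub :: "'a pair_pre_digraph \<Rightarrow> 'a set \<Rightarrow> ('a \<times> bool) list set set" where
  "raag_sub \<Gamma> Y = generate (raag \<Gamma>) (gen \<Gamma> ` Y)"

definition St_K :: "'a pair_pre_digraph \<Rightarrow> (('a \<times> bool) list set \<Rightarrow> ('a \<times> bool) list set) set" where
  "St_K \<Gamma> = {\<phi> \<in> carrier (right_Aut (raag \<Gamma>)).
    \<forall>Y \<in> adm \<Gamma> ` pverts \<Gamma>. \<phi> ` raag_sub \<Gamma> Y = raag_sub \<Gamma> Y}"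

definition St_v :: "'a pair_pre_digraph \<Rightarrow> 'a \<Rightarrow> (('a \<times> bool) list set \<Rightarrow> ('a \<times> bool) list set) set" where
  "St_v \<Gamma> x = {\<phi> \<in> St_K \<Gamma>. \<forall>y \<in> pverts \<Gamma> - nbh_class \<Gamma> x. \<phi> (gen \<Gamma> y) = gen \<Gamma> y}"

definition St_v_group ::
  "'a pair_pre_digraph \<Rightarrow> 'a \<Rightarrow> (('a \<times> bool) list set \<Rightarrow> ('a \<times> bool) list set) monoid" where
  "St_v_group \<Gamma> x = (right_Aut (raag \<Gamma>)) \<lparr> carrier := St_v \<Gamma> x \<rparr>"

lemma subgroup_St_v: "subgroup (St_v \<Gamma> x) (right_Aut (raag \<Gamma>))"
proof -
  interpret G: group "raag \<Gamma>" unfolding raag_def by (rule group_presented_group)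
  interpret A: group "right_Aut (raag \<Gamma>)" by (rule G.group_right_Aut)
  have gen: "gen \<Gamma> y \<in> carrier (raag \<Gamma>)" if "y \<in> pverts \<Gamma>" for y
    using that by (simp add: gen_def raag_def presented_group_def quotientI)
  have sub: "raag_sub \<Gamma> Y \<subseteq> carrier (raag \<Gamma>)" if "Y \<in> adm \<Gamma> ` pverts \<Gamma>" for Y
    unfolding raag_sub_def using that gen by (intro G.generate_incl) (auto simp: adm_def)
  show ?thesis
  proof (rule A.subgroupI)
    show "St_v \<Gamma> x \<subseteq> carrier (right_Aut (raag \<Gamma>))" by (auto simp: St_v_def St_K_def)
    have "(\<lambda>g\<in>carrier (raag \<Gamma>). g) ` raag_sub \<Gamma> Y = raag_sub \<Gamma> Y" if "Y \<in> adm \<Gamma> ` pverts \<Gamma>" for Y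
      using sub[OF that] by (force simp: image_iff)
    then have "\<one>\<^bsub>right_Aut (raag \<Gamma>)\<^esub> \<in> St_v \<Gamma> x"
      using A.one_closed gen by (simp add: St_v_def St_K_def right_Aut_simps)
    then show "St_v \<Gamma> x \<noteq> {}" by blast
  next
    fix \<phi> assume \<phi>: "\<phi> \<in> St_v \<Gamma> x"
    let ?\<psi> = "inv\<^bsub>right_Aut (raag \<Gamma>)\<^esub> \<phi>"
    have car: "\<phi> \<in> carrier (right_Aut (raag \<Gamma>))" using \<phi> by (simp add: St_v_def St_K_def)
    then have car': "?\<psi> \<in> carrier (right_Aut (raag \<Gamma>))" by simp
    have inv: "?\<psi> (\<phi> g) = g" if "g \<in> carrier (raag \<Gamma>)" for g
      using fun_cong[OF A.r_inv[OF car], of g] car car' that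
      by (simp add: right_Aut_simps compose_eq)
    have "?\<psi> ` raag_sub \<Gamma> Y = raag_sub \<Gamma> Y" if Y: "Y \<in> adm \<Gamma> ` pverts \<Gamma>" for Y
    proof -
      have "\<phi> ` raag_sub \<Gamma> Y = raag_sub \<Gamma> Y" using \<phi> Y by (auto simp: St_v_def St_K_def)
      then have "?\<psi> ` raag_sub \<Gamma> Y = (\<lambda>g. ?\<psi> (\<phi> g)) ` raag_sub \<Gamma> Y" by (metis image_image)
      also have "\<dots> = (\<lambda>g. g) ` raag_sub \<Gamma> Y" using sub[OF Y] inv by (intro image_cong) auto
      finally show ?thesis by simp
    qed
    moreover have "?\<psi> (gen \<Gamma> y) = gen \<Gamma> y" if "y \<in> pverts \<Gamma> - nbh_class \<Gamma> x" for y
      using inv[of "gen \<Gamma> y"] \<phi> that gen by (simp add: St_v_def)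
    ultimately show "?\<psi> \<in> St_v \<Gamma> x" using car' by (simp add: St_v_def St_K_def)
  next
    fix \<phi> \<psi> assume \<phi>: "\<phi> \<in> St_v \<Gamma> x" and \<psi>: "\<psi> \<in> St_v \<Gamma> x"
    let ?\<chi> = "\<phi> \<otimes>\<^bsub>right_Aut (raag \<Gamma>)\<^esub> \<psi>"
    have car: "\<phi> \<in> carrier (right_Aut (raag \<Gamma>))" "\<psi> \<in> carrier (right_Aut (raag \<Gamma>))"
      using \<phi> \<psi> by (simp_all add: St_v_def St_K_def)
    have app: "?\<chi> g = \<psi> (\<phi> g)" if "g \<in> carrier (raag \<Gamma>)" for g
      using car that by (simp add: right_Aut_simps compose_eq)
    have "?\<chi> ` raag_sub \<Gamma> Y = raag_sub \<Gamma> Y" if Y: "Y \<in> adm \<Gamma> ` pverts \<Gamma>" for Y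
    proof -
      have "?\<chi> ` raag_sub \<Gamma> Y = (\<lambda>g. \<psi> (\<phi> g)) ` raag_sub \<Gamma> Y"
        using sub[OF Y] app by (intro image_cong) auto
      also have "\<dots> = \<psi> ` (\<phi> ` raag_sub \<Gamma> Y)" by (simp add: image_image)
      also have "\<phi> ` raag_sub \<Gamma> Y = raag_sub \<Gamma> Y" using \<phi> Y by (auto simp: St_v_def St_K_def)
      also have "\<psi> ` raag_sub \<Gamma> Y = raag_sub \<Gamma> Y" using \<psi> Y by (auto simp: St_v_def St_K_def)
      finally show ?thesis .
    qed
    moreover have "?\<chi> (gen \<Gamma> y) = gen \<Gamma> y" if "y \<in> pverts \<Gamma> - nbh_class \<Gamma> x" for y
      using app gen \<phi> \<psi> that by (simp add: St_v_def)
    ultimately show "?\<chi> \<in> St_v \<Gamma> x"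
      using car by (simp add: St_v_def St_K_def)
  qed
qed


section \<open>Integer matrices\<close>

abbreviation GL_int :: "nat \<Rightarrow> int mat monoid" where
  "GL_int n \<equiv> units_of (ring_mat TYPE(int) n ())"

abbreviation M_int :: "nat \<Rightarrow> nat \<Rightarrow> int mat monoid" where
  "M_int a b \<equiv> monoid_mat TYPE(int) a b"

definition GL_action :: "nat \<Rightarrow> nat \<Rightarrow> int mat \<Rightarrow> int mat \<Rightarrow> int mat" where
  "GL_action s m A = (\<lambda>B \<in> carrier (M_int s m). inv\<^bsub>GL_int s\<^esub> A * B)"

end

theory Submission
  imports Defs "HOL-Algebra.Elementary_Groups"
begin

text \<open>Write \<open>C = a(x) = cl(x)\<close> and \<open>U = [x]\<close>. Every vertex of \<open>C\<close> lies in the star of every vertex of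
  \<open>st(x)\<close>, so \<open>G(C)\<close> is free abelian on \<open>C\<close>, with coordinates the exponent homomorphisms
  \<open>G \<rightarrow> \<int>\<close>; moreover \<open>U \<subseteq> C\<close>, and all \<open>u \<in> U\<close> have \<open>st(u) = st(x)\<close>. An element of \<open>St_v\<close>
  sends \<open>U\<close> into \<open>G(C)\<close> and is therefore given by a block row \<open>(A | B)\<close> of integers. Conversely any
  such row extends to an endomorphism, because a neighbour of \<open>u \<in> U\<close> commutes with all of \<open>G(C)\<close>, and
  this endomorphism preserves every \<open>G(a(y))\<close>, because \<open>a(y)\<close> contains \<open>C\<close> as soon as it meets \<open>U\<close>.
  Composition is the product of the matrices with rows \<open>(A | B)\<close> and \<open>(0 | 1)\<close>, so that invertibility
  means \<open>A \<in> GL(s, \<int>)\<close>.\<close>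

section \<open>Homomorphisms out of a presented group\<close>

text \<open>Centralizers are subgroups, so commutation passes from generators to generated subgroups
  one side at a time: \<open>left\<close> fixes an element of \<open>T\<close> and lets
  \<open>a\<close> grow, then \<open>a\<close> stays fixed while \<open>b\<close> grows.\<close>

lemma (in group) generate_commute:
  assumes "S \<subseteq> carrier G" "T \<subseteq> carrier G"
    and "\<And>a b. a \<in> S \<Longrightarrow> b \<in> T \<Longrightarrow> a \<otimes> b = b \<otimes> a"
    and "a \<in> generate G S" "b \<in> generate G T"
  shows "a \<otimes> b = b \<otimes> a"
proof -
  have inv_comm: "inv a \<otimes> b = b \<otimes> inv a"
    if "a \<otimes> b = b \<otimes> a" "a \<in> carrier G" "b \<in> carrier G" for a b
    using that by (metis inv_closed inv_solve_left inv_solve_right m_assoc m_closed)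
  have mult: "(a \<otimes> b) \<otimes> c = c \<otimes> (a \<otimes> b)"
    if "a \<otimes> c = c \<otimes> a" "b \<otimes> c = c \<otimes> b" "a \<in> carrier G" "b \<in> carrier G" "c \<in> carrier G" for a b c
    using that by (metis m_assoc)
  have S: "a \<in> carrier G" if "a \<in> generate G S" for a
    using generate_in_carrier[OF assms(1) that] .
  have T: "b \<in> carrier G" if "b \<in> generate G T" for b
    using generate_in_carrier[OF assms(2) that] .
  have left: "a \<otimes> b = b \<otimes> a" if "b \<in> T" for b
    using assms(4)
  proof (induction rule: generate.induct)
    case one
    then show ?case using that assms(2) by auto
  next
    case (incl h)
    then show ?case using that assms(3) by auto
  next
    case (inv h)
    then show ?case using inv_comm that assms(1,2,3) by blast
  next
    case (eng h1 h2)
    then show ?case using mult S that assms(2) by blast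
  qed
  show ?thesis
    using assms(5)
  proof (induction rule: generate.induct)
    case one
    then show ?case using S assms(4) by auto
  next
    case (incl h)
    then show ?case using left by auto
  next
    case (inv h)
    then show ?case
      using inv_comm[of h a] left S assms(2,4) by auto
  next
    case (eng h1 h2)
    then show ?case using mult[of h1 a h2] T S[OF assms(4)] by auto
  qed
qed

lemma hom_eq_on_generate:
  assumes "group G" "group H" "f \<in> hom G H" "g \<in> hom G H" "S \<subseteq> carrier G"
    and "\<And>a. a \<in> S \<Longrightarrow> f a = g a" "a \<in> generate G S"
  shows "f a = g a"
proof -
  interpret f: group_hom G H f using assms by (simp add: group_hom_def group_hom_axioms_def)
  interpret g: group_hom G H g using assms by (simp add: group_hom_def group_hom_axioms_def)
  show ?thesis
    using assms(7)
  proof (induction rule: generate.induct)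
    case (eng h1 h2)
    then show ?case using group.generate_in_carrier[OF assms(1,5)] by simp
  qed (use assms(5,6) f.hom_inv g.hom_inv in auto)
qed

section \<open>Evaluation of words and the universal property of a presentation\<close>

definition word_value :: "('g, 'c) monoid_scheme \<Rightarrow> ('a \<Rightarrow> 'g) \<Rightarrow> ('a \<times> bool) list \<Rightarrow> 'g" where
  "word_value G f w =
    foldr (\<lambda>(x, b) g. (if b then f x else inv\<^bsub>G\<^esub> (f x)) \<otimes>\<^bsub>G\<^esub> g) w \<one>\<^bsub>G\<^esub>"

lemma word_value_simps:
  "word_value G f [] = \<one>\<^bsub>G\<^esub>"
  "word_value G f ((x, b) # w) = (if b then f x else inv\<^bsub>G\<^esub> (f x)) \<otimes>\<^bsub>G\<^esub> word_value G f w"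
  by (simp_all add: word_value_def)

context group
begin

lemma word_value_closed:
  "f ` X \<subseteq> carrier G \<Longrightarrow> w \<in> words X \<Longrightarrow> word_value G f w \<in> carrier G"
  by (induction w) (auto simp: word_value_simps)

lemma word_value_append:
  "f ` X \<subseteq> carrier G \<Longrightarrow> u \<in> words X \<Longrightarrow> v \<in> words X \<Longrightarrow>
    word_value G f (u @ v) = word_value G f u \<otimes> word_value G f v"
proof (induction u)
  case Nil
  then show ?case by (simp add: word_value_simps word_value_closed)
next
  case (Cons p u)
  then show ?case
    by (cases p) (auto simp: word_value_simps m_assoc word_value_closed image_subset_iff)
qed

text \<open>Evaluation is unchanged by each elementary move, a cancellation or the deletion of a
  relator; the closure rules are harmless because equality is itself an equivalence
  relation.\<close>

lemma word_value_word_rel: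
  assumes "f ` X \<subseteq> carrier G" "\<And>r. r \<in> R \<Longrightarrow> r \<in> words X \<Longrightarrow> word_value G f r = \<one>"
    and "(u, v) \<in> word_rel X R"
  shows "word_value G f u = word_value G f v"
  using assms(3)
proof (induction rule: word_rel.induct)
  case (cancel u v x b)
  have fx: "f x \<in> carrier G" using cancel assms(1) by auto
  have v: "word_value G f v \<in> carrier G" using cancel assms(1) by (intro word_value_closed)
  have "word_value G f ([(x, b), (x, \<not> b)] @ v) = word_value G f v"
    using fx v by (cases b) (simp_all add: word_value_simps flip: m_assoc)
  then show ?case
    using cancel by (simp add: word_value_append[OF assms(1)] del: append_Cons append_Nil)
next
  case (relator u v r)
  then show ?case
    using assms(1,2) by (simp add: word_value_append[OF assms(1)] word_value_closed)
qed auto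

lemma presented_group_lift:
  assumes "f ` X \<subseteq> carrier G" "\<And>r. r \<in> R \<Longrightarrow> r \<in> words X \<Longrightarrow> word_value G f r = \<one>"
  shows "\<exists>h \<in> hom (presented_group X R) G. \<forall>x \<in> X. h (word_rel X R `` {[(x, True)]}) = f x"
proof -
  \<comment> \<open>Any representative of the class may be evaluated, since equivalent words have
    the same value.\<close>
  define h where "h a = word_value G f (SOME w. w \<in> a)" for a
  have h: "h (word_rel X R `` {w}) = word_value G f w" if "w \<in> words X" for w
  proof -
    have "w \<in> word_rel X R `` {w}" using that by (simp add: word_rel.refl)
    then have "(w, SOME v. v \<in> word_rel X R `` {w}) \<in> word_rel X R"
      by (metis Image_singleton_iff someI)
    then show ?thesis unfolding h_def using word_value_word_rel[OF assms] by metis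
  qed
  have "h \<in> hom (presented_group X R) G"
    by (rule homI)
      (auto elim!: presented_group_carrierE
        simp: presented_group_mult h word_value_append[OF assms(1)] word_value_closed[OF assms(1)])
  moreover have "h (word_rel X R `` {[(x, True)]}) = f x" if "x \<in> X" for x
    using that assms(1) by (auto simp: h word_value_simps)
  ultimately show ?thesis by blast
qed

end

text \<open>This is the uniqueness half of the universal property: homomorphisms are determined by
  the generators. The induction peels off one letter of a representing word at a time.\<close>

lemma presented_group_generated:
  assumes "a \<in> carrier (presented_group X R)"
  shows "a \<in> generate (presented_group X R) ((\<lambda>x. word_rel X R `` {[(x, True)]}) ` X)"
proof -
  interpret P: group "presented_group X R" by (rule group_presented_group)
  let ?S = "(\<lambda>x. word_rel X R `` {[(x, True)]}) ` X"
  have car: "word_rel X R `` {w} \<in> carrier (presented_group X R)" if "w \<in> words X" for w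
    using that by (simp add: presented_group_def quotientI)
  have letter: "word_rel X R `` {[(x, b)]} \<in> generate (presented_group X R) ?S" if x: "x \<in> X" for x b
  proof (cases b)
    case True
    then show ?thesis using x by (auto intro: generate.incl)
  next
    case False
    \<comment> \<open>The cancellation rule identifies the class of the negative letter with the
      group inverse of the class of the positive one.\<close>
    have "([(x, False), (x, True)], []) \<in> word_rel X R"
      using word_rel.cancel[of "[]" X "[]" x False R] x by simp
    then have "word_rel X R `` {[(x, False)]} \<otimes>\<^bsub>presented_group X R\<^esub> word_rel X R `` {[(x, True)]}
      = \<one>\<^bsub>presented_group X R\<^esub>"
      using x by (simp add: presented_group_mult equiv_class_eq[OF equiv_word_rel])
        (simp add: presented_group_def)
    then have "word_rel X R `` {[(x, False)]}
      = inv\<^bsub>presented_group X R\<^esub> (word_rel X R `` {[(x, True)]})"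
      using x car by (intro P.inv_equality[symmetric]) auto
    then show ?thesis using x False by (auto intro: generate.inv)
  qed
  have "word_rel X R `` {w} \<in> generate (presented_group X R) ?S" if "w \<in> words X" for w
    using that
  proof (induction w)
    case Nil
    then show ?case
      using generate.one[of "presented_group X R" ?S] by (simp add: presented_group_def)
  next
    case (Cons p w)
    obtain x b where p: "p = (x, b)" by fastforce
    have "word_rel X R `` {[(x, b)]} \<otimes>\<^bsub>presented_group X R\<^esub> word_rel X R `` {w}
      \<in> generate (presented_group X R) ?S"
      using Cons letter p by (intro generate.eng) auto
    then show ?case using Cons.prems p by (simp add: presented_group_mult)
  qed
  then show ?thesis using assms by (auto elim: presented_group_carrierE)
qed

section \<open>Exponents in a partially commutative group\<close>

locale simple_graph =
  fixes \<Gamma> :: "'a pair_pre_digraph"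
  assumes pair_graph: "pair_graph \<Gamma>"
begin

abbreviation V :: "'a set" where "V \<equiv> pverts \<Gamma>"

sublocale group "raag \<Gamma>"
  unfolding raag_def by (rule group_presented_group)

lemma finite_V: "finite V"
proof -
  interpret pair_graph \<Gamma> by (rule pair_graph)
  show ?thesis by (rule pair_finite_verts)
qed

lemma arc_in_V:
  assumes "(y, z) \<in> parcs \<Gamma>"
  shows "y \<in> V \<and> z \<in> V"
proof -
  interpret pair_graph \<Gamma> by (rule pair_graph)
  show ?thesis using in_arcsD1[OF assms] in_arcsD2[OF assms] by (rule conjI)
qed

lemma arc_sym:
  assumes "(y, z) \<in> parcs \<Gamma>"
  shows "(z, y) \<in> parcs \<Gamma>"
proof -
  interpret pair_graph \<Gamma> by (rule pair_graph)
  show ?thesis using assms by (rule arcs_symmetric)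
qed

lemma arc_irrefl: "(y, y) \<notin> parcs \<Gamma>"
proof -
  interpret pair_graph \<Gamma> by (rule pair_graph)
  show ?thesis using no_loops'[of y y] by auto
qed

section \<open>Vertex generators and the subgroups they generate\<close>

lemma gen_closed: "y \<in> V \<Longrightarrow> gen \<Gamma> y \<in> carrier (raag \<Gamma>)"
  by (simp add: gen_def raag_def presented_group_def quotientI)

lemma gen_image_closed: "Y \<subseteq> V \<Longrightarrow> gen \<Gamma> ` Y \<subseteq> carrier (raag \<Gamma>)"
  using gen_closed by auto

lemma raag_sub_closed: "Y \<subseteq> V \<Longrightarrow> g \<in> raag_sub \<Gamma> Y \<Longrightarrow> g \<in> carrier (raag \<Gamma>)"
  unfolding raag_sub_def by (rule generate_in_carrier[OF gen_image_closed])

lemma raag_sub_subgroup: "Y \<subseteq> V \<Longrightarrow> subgroup (raag_sub \<Gamma> Y) (raag \<Gamma>)"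
  unfolding raag_sub_def by (rule generate_is_subgroup[OF gen_image_closed])

lemma raag_sub_mono: "Y \<subseteq> Z \<Longrightarrow> raag_sub \<Gamma> Y \<subseteq> raag_sub \<Gamma> Z"
  unfolding raag_sub_def by (rule mono_generate) auto

lemma gen_raag_sub: "y \<in> Y \<Longrightarrow> gen \<Gamma> y \<in> raag_sub \<Gamma> Y"
  unfolding raag_sub_def by (auto intro: generate.incl)

lemma raag_generated: "g \<in> carrier (raag \<Gamma>) \<Longrightarrow> g \<in> raag_sub \<Gamma> V"
  using presented_group_generated unfolding raag_def raag_sub_def gen_def by blast

lemma raag_hom_eq:
  assumes "group H" "\<phi> \<in> hom (raag \<Gamma>) H" "\<psi> \<in> hom (raag \<Gamma>) H"
    and "\<And>y. y \<in> V \<Longrightarrow> \<phi> (gen \<Gamma> y) = \<psi> (gen \<Gamma> y)" "g \<in> carrier (raag \<Gamma>)"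
  shows "\<phi> g = \<psi> g"
proof (rule hom_eq_on_generate[OF is_group assms(1-3) gen_image_closed[OF order_refl]])
  show "g \<in> generate (raag \<Gamma>) (gen \<Gamma> ` V)"
    using raag_generated[OF assms(5)] by (simp add: raag_sub_def)
qed (use assms(4) in auto)

lemma gen_commute:
  assumes "(y, z) \<in> parcs \<Gamma>"
  shows "gen \<Gamma> y \<otimes>\<^bsub>raag \<Gamma>\<^esub> gen \<Gamma> z = gen \<Gamma> z \<otimes>\<^bsub>raag \<Gamma>\<^esub> gen \<Gamma> y"
proof -
  let ?R = "{commutator_word y z |y z. (y, z) \<in> parcs \<Gamma>}"
  let ?r = "word_rel V ?R"
  have yz: "y \<in> V" "z \<in> V" using arc_in_V[OF assms] by auto
  \<comment> \<open>The word \<open>z y\<close> followed by the commutator of \<open>y\<close> and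
    \<open>z\<close> equals \<open>z y\<close> by the relator, and reduces freely to
    \<open>y z\<close> by two cancellations.\<close>
  have 1: "([(z, True), (y, True)] @ commutator_word y z @ [], [(z, True), (y, True)] @ []) \<in> ?r"
    using yz assms by (intro word_rel.relator) (auto simp: commutator_word_def)
  have 2: "([(z, True)] @ [(y, True), (y, \<not> True)] @ [(z, False), (y, True), (z, True)],
    [(z, True)] @ [(z, False), (y, True), (z, True)]) \<in> ?r"
    using yz by (intro word_rel.cancel) auto
  have 3: "([] @ [(z, True), (z, \<not> True)] @ [(y, True), (z, True)], [] @ [(y, True), (z, True)]) \<in> ?r"
    using yz by (intro word_rel.cancel) auto
  have "([(y, True), (z, True)], [(z, True), (y, True)]) \<in> ?r"
    using word_rel.sym[OF word_rel.trans[OF 2[simplified] 3[simplified]]] 1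
    by (auto simp: commutator_word_def intro: word_rel.trans)
  then show ?thesis
    using yz unfolding raag_def gen_def
    by (simp add: presented_group_mult equiv_class_eq[OF equiv_word_rel])
qed

lemma raag_lift:
  assumes "group H" "f ` V \<subseteq> carrier H"
    and comm: "\<And>y z. (y, z) \<in> parcs \<Gamma> \<Longrightarrow> f y \<otimes>\<^bsub>H\<^esub> f z = f z \<otimes>\<^bsub>H\<^esub> f y"
  shows "\<exists>h \<in> hom (raag \<Gamma>) H. \<forall>v \<in> V. h (gen \<Gamma> v) = f v"
proof -
  interpret H: group H by fact
  have "word_value H f (commutator_word y z) = \<one>\<^bsub>H\<^esub>" if "(y, z) \<in> parcs \<Gamma>" for y z
  proof -
    have yz: "f y \<in> carrier H" "f z \<in> carrier H" using arc_in_V[OF that] assms(2) by auto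
    have "word_value H f (commutator_word y z)
      = inv\<^bsub>H\<^esub> f y \<otimes>\<^bsub>H\<^esub> (inv\<^bsub>H\<^esub> f z \<otimes>\<^bsub>H\<^esub> (f y \<otimes>\<^bsub>H\<^esub> f z))"
      using yz by (simp add: commutator_word_def word_value_simps)
    also have "\<dots> = inv\<^bsub>H\<^esub> f y \<otimes>\<^bsub>H\<^esub> (inv\<^bsub>H\<^esub> f z \<otimes>\<^bsub>H\<^esub> (f z \<otimes>\<^bsub>H\<^esub> f y))"
      using comm[OF that] by simp
    also have "\<dots> = \<one>\<^bsub>H\<^esub>" using yz by (simp flip: H.m_assoc)
    finally show ?thesis .
  qed
  then show ?thesis
    using H.presented_group_lift[OF assms(2), of "{commutator_word y z |y z. (y, z) \<in> parcs \<Gamma>}"]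
    unfolding raag_def gen_def by blast
qed

text \<open>On the carrier this is the exponent sum of the letter \<open>v\<close> in any
  representing word. The choice is legitimate because the integers are commutative, so every
  assignment of integers to vertices extends to a homomorphism.\<close>

definition expo :: "'a \<Rightarrow> ('a \<times> bool) list set \<Rightarrow> int" where
  "expo v = (SOME h. h \<in> hom (raag \<Gamma>) integer_group \<and> (\<forall>w \<in> V. h (gen \<Gamma> w) = of_bool (w = v)))"

lemma expo:
  shows expo_hom: "expo v \<in> hom (raag \<Gamma>) integer_group"
    and expo_gen: "w \<in> V \<Longrightarrow> expo v (gen \<Gamma> w) = of_bool (w = v)"
proof -
  have "\<exists>h. h \<in> hom (raag \<Gamma>) integer_group \<and> (\<forall>w \<in> V. h (gen \<Gamma> w) = of_bool (w = v))"
    using raag_lift[of integer_group "\<lambda>w. of_bool (w = v)"] by auto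
  from someI_ex[OF this] show "expo v \<in> hom (raag \<Gamma>) integer_group"
    "w \<in> V \<Longrightarrow> expo v (gen \<Gamma> w) = of_bool (w = v)"
    unfolding expo_def by blast+
qed

lemma expo_mult:
  "g \<in> carrier (raag \<Gamma>) \<Longrightarrow> h \<in> carrier (raag \<Gamma>) \<Longrightarrow>
    expo v (g \<otimes>\<^bsub>raag \<Gamma>\<^esub> h) = expo v g + expo v h"
  using hom_mult[OF expo_hom] by simp

lemma expo_inv: "g \<in> carrier (raag \<Gamma>) \<Longrightarrow> expo v (inv\<^bsub>raag \<Gamma>\<^esub> g) = - expo v g"
  using group_hom.hom_inv[of "raag \<Gamma>" integer_group "expo v" g] expo_hom
  by (simp add: group_hom_def group_hom_axioms_def is_group)

lemma expo_int_pow: "g \<in> carrier (raag \<Gamma>) \<Longrightarrow> expo v (g [^]\<^bsub>raag \<Gamma>\<^esub> (n::int)) = n * expo v g"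
  using hom_int_pow[OF expo_hom _ is_group group_integer_group, of g v n] by simp

text \<open>Both sides are additive in \<open>g\<close> and agree on the generators from
  \<open>Y\<close>. Taking \<open>h\<close> to be an exponent composed with an endomorphism later
  yields the rule for matrix products.\<close>

lemma hom_integer_expo:
  assumes "Y \<subseteq> V" "h \<in> hom (raag \<Gamma>) integer_group" "g \<in> raag_sub \<Gamma> Y"
  shows "h g = (\<Sum>c\<in>Y. expo c g * h (gen \<Gamma> c))"
proof -
  interpret h: group_hom "raag \<Gamma>" integer_group h
    using assms(2) by (simp add: group_hom_def group_hom_axioms_def is_group)
  have fin: "finite Y" using assms(1) finite_V finite_subset by blast
  have expo_one: "expo c \<one>\<^bsub>raag \<Gamma>\<^esub> = 0" for c
    using expo_mult[of "\<one>\<^bsub>raag \<Gamma>\<^esub>" "\<one>\<^bsub>raag \<Gamma>\<^esub>" c] by simp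
  have sum_gen: "(\<Sum>c\<in>Y. expo c (gen \<Gamma> y) * h (gen \<Gamma> c)) = h (gen \<Gamma> y)" if "y \<in> Y" for y
  proof -
    have "(\<Sum>c\<in>Y. expo c (gen \<Gamma> y) * h (gen \<Gamma> c)) = (\<Sum>c\<in>Y. if c = y then h (gen \<Gamma> y) else 0)"
      using that assms(1) by (intro sum.cong) (auto simp: expo_gen subset_iff)
    then show ?thesis using that fin by simp
  qed
  show ?thesis
    using assms(3) unfolding raag_sub_def
  proof (induction rule: generate.induct)
    case one
    then show ?case using expo_one h.hom_one by simp
  next
    case (incl g)
    then show ?case using sum_gen by auto
  next
    case (inv g)
    then obtain y where y: "y \<in> Y" "g = gen \<Gamma> y" by auto
    then have "g \<in> carrier (raag \<Gamma>)" using assms(1) gen_closed by auto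
    then show ?case using sum_gen[OF y(1)] y h.hom_inv by (simp add: expo_inv sum_negf)
  next
    case (eng a b)
    then have "a \<in> carrier (raag \<Gamma>)" "b \<in> carrier (raag \<Gamma>)"
      using generate_in_carrier[OF gen_image_closed[OF assms(1)]] by auto
    then show ?case
      using eng.IH h.hom_mult by (simp add: expo_mult distrib_right sum.distrib)
  qed
qed

lemma expo_eq_0: "Y \<subseteq> V \<Longrightarrow> v \<notin> Y \<Longrightarrow> g \<in> raag_sub \<Gamma> Y \<Longrightarrow> expo v g = 0"
  by (subst hom_integer_expo[OF _ expo_hom]) (auto intro!: sum.neutral simp: expo_gen subset_iff)

text \<open>The element is a product of powers of generators, built one vertex at a time. The new
  power leaves the old exponents alone, and the old product has exponent 0 at the new
  vertex.\<close>

lemma ex_expo: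
  assumes "Y \<subseteq> V"
  shows "\<exists>g \<in> raag_sub \<Gamma> Y. \<forall>y \<in> Y. expo y g = n y"
proof -
  have "finite Y" using assms finite_V finite_subset by blast
  then show ?thesis
    using assms
  proof (induction rule: finite_induct)
    case empty
    then show ?case by (auto simp: raag_sub_def intro: generate.one)
  next
    case (insert c Y)
    then obtain g where g: "g \<in> raag_sub \<Gamma> Y" "\<forall>y \<in> Y. expo y g = n y" by auto
    let ?c = "gen \<Gamma> c [^]\<^bsub>raag \<Gamma>\<^esub> n c"
    have car: "gen \<Gamma> c \<in> carrier (raag \<Gamma>)" "?c \<in> carrier (raag \<Gamma>)" "g \<in> carrier (raag \<Gamma>)"
      using insert.prems g raag_sub_closed gen_closed by auto
    interpret S: subgroup "raag_sub \<Gamma> (insert c Y)" "raag \<Gamma>"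
      using insert.prems by (rule raag_sub_subgroup)
    have "?c \<in> raag_sub \<Gamma> (insert c Y)"
      by (rule subgroup_int_pow_closed[OF S.subgroup_axioms]) (simp add: gen_raag_sub)
    moreover have "g \<in> raag_sub \<Gamma> (insert c Y)" using g raag_sub_mono[of Y "insert c Y"] by auto
    moreover have "expo y (?c \<otimes>\<^bsub>raag \<Gamma>\<^esub> g) = n y" if "y \<in> insert c Y" for y
      using that g car insert.prems insert.hyps expo_eq_0[of Y c g]
      by (auto simp: expo_mult expo_int_pow expo_gen)
    ultimately show ?case by blast
  qed
qed

lemma raag_sub_commute:
  assumes "Y \<subseteq> V" "Z \<subseteq> V" "\<And>y z. y \<in> Y \<Longrightarrow> z \<in> Z \<Longrightarrow> y \<in> st \<Gamma> z"
    and "g \<in> raag_sub \<Gamma> Y" "h \<in> raag_sub \<Gamma> Z"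
  shows "g \<otimes>\<^bsub>raag \<Gamma>\<^esub> h = h \<otimes>\<^bsub>raag \<Gamma>\<^esub> g"
  using assms(4,5) unfolding raag_sub_def
  by (rule generate_commute[OF gen_image_closed[OF assms(1)] gen_image_closed[OF assms(2)], rotated])
    (use assms(3) gen_commute in \<open>force simp: st_def lk_def\<close>)

text \<open>Exponents are faithful coordinates over a clique. In the induction the new generator
  commutes with everything generated so far, so each element has the form \<open>c^n a\<close> with
  \<open>a\<close> in the smaller subgroup; the exponent at \<open>c\<close> forces
  \<open>n = 0\<close>, and the induction hypothesis disposes of \<open>a\<close>.\<close>

lemma expo_trivial:
  assumes "Y \<subseteq> V" "\<And>y z. y \<in> Y \<Longrightarrow> z \<in> Y \<Longrightarrow> y \<in> st \<Gamma> z"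
    and "g \<in> raag_sub \<Gamma> Y" "\<And>y. y \<in> Y \<Longrightarrow> expo y g = 0"
  shows "g = \<one>\<^bsub>raag \<Gamma>\<^esub>"
proof -
  have "finite Y" using assms finite_V finite_subset by blast
  then show ?thesis
    using assms
  proof (induction arbitrary: g rule: finite_induct)
    case empty
    then show ?case using generate_empty by (simp add: raag_sub_def)
  next
    case (insert c Y)
    interpret S: subgroup "raag_sub \<Gamma> Y" "raag \<Gamma>"
      using insert.prems(1) by (intro raag_sub_subgroup) auto
    let ?c = "\<lambda>n::int. gen \<Gamma> c [^]\<^bsub>raag \<Gamma>\<^esub> n"
    have c: "gen \<Gamma> c \<in> carrier (raag \<Gamma>)" using insert.prems(1) gen_closed by auto
    have pow: "?c n \<in> raag_sub \<Gamma> {c}" for n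
      using insert.prems(1) gen_raag_sub
      by (intro subgroup_int_pow_closed[OF raag_sub_subgroup]) auto
    have comm: "a \<otimes>\<^bsub>raag \<Gamma>\<^esub> ?c n = ?c n \<otimes>\<^bsub>raag \<Gamma>\<^esub> a" if "a \<in> raag_sub \<Gamma> Y" for a n
      using insert.prems(1,2) by (intro raag_sub_commute[OF _ _ _ that pow]) auto
    have "\<exists>n. \<exists>a \<in> raag_sub \<Gamma> Y. g = ?c n \<otimes>\<^bsub>raag \<Gamma>\<^esub> a"
      using insert.prems(3) unfolding raag_sub_def
    proof (induction rule: generate.induct)
      case one
      then show ?case
        by (intro exI[of _ 0] bexI[of _ "\<one>\<^bsub>raag \<Gamma>\<^esub>"]) (auto intro: generate.one)
    next
      case (incl h)
      then consider "h = gen \<Gamma> c" | "h \<in> gen \<Gamma> ` Y" by auto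
      then show ?case
      proof cases
        case 1
        then show ?thesis using c
          by (intro exI[of _ 1] bexI[of _ "\<one>\<^bsub>raag \<Gamma>\<^esub>"]) (auto intro: generate.one)
      next
        case 2
        then have "h \<in> carrier (raag \<Gamma>)" using insert.prems(1) gen_closed by auto
        then show ?thesis using 2
          by (intro exI[of _ 0] bexI[of _ h]) (auto intro: generate.incl)
      qed
    next
      case (inv h)
      then consider "h = gen \<Gamma> c" | "h \<in> gen \<Gamma> ` Y" by auto
      then show ?case
      proof cases
        case 1
        then show ?thesis using c
          by (intro exI[of _ "-1"] bexI[of _ "\<one>\<^bsub>raag \<Gamma>\<^esub>"]) (auto intro: generate.one simp: int_pow_neg)
      next
        case 2
        then have "h \<in> carrier (raag \<Gamma>)" using insert.prems(1) gen_closed by auto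
        then show ?thesis using 2
          by (intro exI[of _ 0] bexI[of _ "inv\<^bsub>raag \<Gamma>\<^esub> h"]) (auto intro: generate.inv)
      qed
    next
      case (eng h1 h2)
      then obtain m n a b where ab: "a \<in> raag_sub \<Gamma> Y" "b \<in> raag_sub \<Gamma> Y"
        "h1 = ?c m \<otimes>\<^bsub>raag \<Gamma>\<^esub> a" "h2 = ?c n \<otimes>\<^bsub>raag \<Gamma>\<^esub> b"
        unfolding raag_sub_def by blast
      \<comment> \<open>The product regains the normal form by moving the second power of
        \<open>c\<close> to the left past \<open>a\<close>.\<close>
      have "h1 \<otimes>\<^bsub>raag \<Gamma>\<^esub> h2 = ?c m \<otimes>\<^bsub>raag \<Gamma>\<^esub> (a \<otimes>\<^bsub>raag \<Gamma>\<^esub> ?c n) \<otimes>\<^bsub>raag \<Gamma>\<^esub> b"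
        using ab c by (simp add: m_assoc)
      also have "\<dots> = ?c m \<otimes>\<^bsub>raag \<Gamma>\<^esub> (?c n \<otimes>\<^bsub>raag \<Gamma>\<^esub> a) \<otimes>\<^bsub>raag \<Gamma>\<^esub> b"
        by (simp only: comm[OF ab(1)])
      also have "\<dots> = ?c (m + n) \<otimes>\<^bsub>raag \<Gamma>\<^esub> (a \<otimes>\<^bsub>raag \<Gamma>\<^esub> b)"
        using ab c by (simp add: m_assoc int_pow_mult)
      finally show ?case using S.m_closed[OF ab(1,2)] unfolding raag_sub_def by blast
    qed
    then obtain n a where a: "a \<in> raag_sub \<Gamma> Y" "g = ?c n \<otimes>\<^bsub>raag \<Gamma>\<^esub> a" by blast
    have e: "expo y g = n * of_bool (c = y) + expo y a" for y
      using a c insert.prems(1) by (simp add: expo_mult expo_int_pow expo_gen)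
    \<comment> \<open>As \<open>c\<close> is a new vertex, \<open>a\<close> contributes nothing at
      \<open>c\<close>, and the exponent of \<open>g\<close> there is exactly
      \<open>n\<close>.\<close>
    have "expo c a = 0" using expo_eq_0[OF _ _ a(1)] insert by auto
    then have "n = 0" using e[of c] insert.prems(4)[of c] by simp
    moreover have "a = \<one>\<^bsub>raag \<Gamma>\<^esub>"
      using insert.prems insert.hyps e by (intro insert.IH[OF _ _ a(1)]) (auto simp: calculation)
    ultimately show ?case using a by simp
  qed
qed

lemma expo_inject:
  assumes "Y \<subseteq> V" "\<And>y z. y \<in> Y \<Longrightarrow> z \<in> Y \<Longrightarrow> y \<in> st \<Gamma> z"
    and gh: "g \<in> raag_sub \<Gamma> Y" "h \<in> raag_sub \<Gamma> Y" and "\<And>y. y \<in> Y \<Longrightarrow> expo y g = expo y h"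
  shows "g = h"
proof -
  interpret S: subgroup "raag_sub \<Gamma> Y" "raag \<Gamma>" using assms(1) by (rule raag_sub_subgroup)
  have "g \<otimes>\<^bsub>raag \<Gamma>\<^esub> inv\<^bsub>raag \<Gamma>\<^esub> h = \<one>\<^bsub>raag \<Gamma>\<^esub>"
    using gh assms(5) by (intro expo_trivial[OF assms(1,2)]) (auto simp: expo_mult expo_inv)
  then show ?thesis using gh by (metis S.mem_carrier inv_equality inv_inv inv_closed)
qed

end

section \<open>The general linear group over the integers\<close>

lemma GL_int_simps:
  "A \<otimes>\<^bsub>GL_int n\<^esub> B = A * B"
  "\<one>\<^bsub>GL_int n\<^esub> = 1\<^sub>m n"
  "A \<in> carrier (GL_int n) \<longleftrightarrow>
    A \<in> carrier_mat n n \<and> (\<exists>P \<in> carrier_mat n n. P * A = 1\<^sub>m n \<and> A * P = 1\<^sub>m n)"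
  by (auto simp: units_of_mult units_of_one units_of_carrier Units_def ring_mat_simps)

lemma M_int_simps:
  "A \<otimes>\<^bsub>M_int a b\<^esub> B = A + B" "\<one>\<^bsub>M_int a b\<^esub> = 0\<^sub>m a b" "carrier (M_int a b) = carrier_mat a b"
  by (simp_all add: monoid_mat_def)

lemma group_GL_int: "group (GL_int n)"
proof -
  interpret ring "ring_mat TYPE(int) n ()" by (rule ring_mat)
  show ?thesis by (rule units_group)
qed

lemma GL_int_inv:
  assumes "A \<in> carrier (GL_int n)"
  shows "inv\<^bsub>GL_int n\<^esub> A \<in> carrier (GL_int n)" "inv\<^bsub>GL_int n\<^esub> A \<in> carrier_mat n n"
    "inv\<^bsub>GL_int n\<^esub> A * A = 1\<^sub>m n" "A * inv\<^bsub>GL_int n\<^esub> A = 1\<^sub>m n"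
proof -
  interpret group "GL_int n" by (rule group_GL_int)
  show 1: "inv\<^bsub>GL_int n\<^esub> A \<in> carrier (GL_int n)" using assms by (rule inv_closed)
  then show "inv\<^bsub>GL_int n\<^esub> A \<in> carrier_mat n n" by (simp add: GL_int_simps(3))
  show "inv\<^bsub>GL_int n\<^esub> A * A = 1\<^sub>m n" "A * inv\<^bsub>GL_int n\<^esub> A = 1\<^sub>m n"
    using l_inv[OF assms] r_inv[OF assms] by (simp_all only: GL_int_simps(1,2))
qed

lemma GL_int_inv_mult:
  assumes "A \<in> carrier (GL_int n)" "B \<in> carrier (GL_int n)"
  shows "inv\<^bsub>GL_int n\<^esub> (A * B) = inv\<^bsub>GL_int n\<^esub> B * inv\<^bsub>GL_int n\<^esub> A"
  using group.inv_mult_group[OF group_GL_int assms] by (simp only: GL_int_simps(1))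

text \<open>Inversion reverses products, and so does the right-hand convention for automorphisms:
  acting by \<open>A\<close> and then by \<open>B\<close> multiplies on the left by
  \<open>inv B * inv A\<close>, the inverse of \<open>A * B\<close>.\<close>

lemma GL_action_hom: "GL_action s m \<in> hom (GL_int s) (right_Aut (M_int s m))"
proof -
  have auto: "GL_action s m A \<in> auto (M_int s m)" if A: "A \<in> carrier (GL_int s)" for A
  proof -
    note inv = GL_int_inv[OF A]
    have car: "A \<in> carrier_mat s s" using A by (simp add: GL_int_simps)
    have "GL_action s m A \<in> hom (M_int s m) (M_int s m)"
      using inv(2) by (intro homI) (auto simp: GL_action_def M_int_simps mult_add_distrib_mat)
    moreover have "bij_betw (GL_action s m A) (carrier (M_int s m)) (carrier (M_int s m))"
      using car inv(2)
      \<comment> \<open>Left multiplication by \<open>A\<close> undoes left multiplication by its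
        inverse.\<close>
      by (intro bij_betw_byWitness[where f' = "\<lambda>B. A * B"])
        (auto simp: GL_action_def M_int_simps inv(3,4) simp flip: assoc_mult_mat)
    moreover have "GL_action s m A \<in> extensional (carrier (M_int s m))"
      by (simp add: GL_action_def)
    ultimately show ?thesis by (simp add: auto_def Bij_def)
  qed
  show ?thesis
  proof (rule homI)
    fix A B assume A: "A \<in> carrier (GL_int s)" and B: "B \<in> carrier (GL_int s)"
    have "compose (carrier (M_int s m)) (GL_action s m B) (GL_action s m A) N = GL_action s m (A * B) N" for N
      using GL_int_inv(2)[OF A] GL_int_inv(2)[OF B]
      by (auto simp: compose_def GL_action_def M_int_simps GL_int_inv_mult[OF A B])
    then show "GL_action s m (A \<otimes>\<^bsub>GL_int s\<^esub> B)
      = GL_action s m A \<otimes>\<^bsub>right_Aut (M_int s m)\<^esub> GL_action s m B"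
      by (simp add: right_Aut_simps(3) auto A B GL_int_simps(1) ext)
  qed (simp add: right_Aut_simps auto)
qed

section \<open>Automorphisms supported on the class of a vertex\<close>

text \<open>The lists fix an ordering: \<open>us\<close> indexes the rows and the columns of the
  square block, \<open>ws\<close> the columns of the remaining block. The list \<open>ws\<close> may
  be empty.\<close>

locale clique_vertex = simple_graph +
  fixes x :: 'a and us ws :: "'a list"
  assumes x: "x \<in> V" and adm_eq_cl: "adm \<Gamma> x = cl \<Gamma> x"
    and us: "distinct us" "set us = nbh_class \<Gamma> x"
    and ws: "distinct ws" "set ws = adm \<Gamma> x - nbh_class \<Gamma> x"
begin

abbreviation C :: "'a set" where "C \<equiv> adm \<Gamma> x"
abbreviation U :: "'a set" where "U \<equiv> nbh_class \<Gamma> x"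
abbreviation s :: nat where "s \<equiv> length us"
abbreviation m :: nat where "m \<equiv> length ws"

section \<open>Position of the class and of the closure in the graph\<close>

lemma st_sym: "y \<in> st \<Gamma> z \<Longrightarrow> z \<in> st \<Gamma> y"
  using arc_sym by (auto simp: st_def lk_def)

lemma U_subset_V: "U \<subseteq> V" by (auto simp: nbh_class_def)

lemma C_subset_V: "C \<subseteq> V" by (auto simp: adm_def)

lemma C_st: "y \<in> C \<Longrightarrow> z \<in> st \<Gamma> x \<Longrightarrow> y \<in> st \<Gamma> z"
  by (simp add: adm_eq_cl cl_def)

lemma C_subset_st: "C \<subseteq> st \<Gamma> x"
  using C_st[of _ x] by (auto simp: st_def)

text \<open>Since \<open>x\<close> belongs to its own star, \<open>C\<close> lies in
  \<open>st(x)\<close>, so membership in \<open>C\<close> supplies the second premise of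
  \<open>C_st\<close>. Hence \<open>C\<close> spans a complete subgraph and its subgroup is
  abelian.\<close>

lemma C_clique: "y \<in> C \<Longrightarrow> z \<in> C \<Longrightarrow> y \<in> st \<Gamma> z"
  using C_st C_subset_st by blast

lemma U_st:
  assumes "u \<in> U"
  shows "st \<Gamma> u = st \<Gamma> x"
proof (cases "st \<Gamma> x = st \<Gamma> u")
  case False
  then have lk: "lk \<Gamma> x = lk \<Gamma> u" and u: "u \<in> V" using assms by (auto simp: nbh_class_def)
  \<comment> \<open>With equal links, every neighbour of \<open>x\<close> is a neighbour of
    \<open>u\<close>; hence \<open>u\<close> lies in \<open>adm\<close>, and thus in
    \<open>st(x)\<close>.\<close>
  have "u \<in> st \<Gamma> z" if "z \<in> lk \<Gamma> x" for z
    using that lk st_sym[of z u] by (simp add: st_def)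
  then have "u \<in> st \<Gamma> x" using u C_subset_st by (auto simp: adm_def)
  \<comment> \<open>Equal links are incompatible with an edge between \<open>u\<close> and \<open>x\<close>, so \<open>u = x\<close>.\<close>
  then show ?thesis using lk arc_irrefl by (auto simp: st_def lk_def)
qed simp

lemma U_subset_C: "U \<subseteq> C"
proof
  fix u assume u: "u \<in> U"
  have "u \<in> st \<Gamma> z" if "z \<in> st \<Gamma> x" for z
    using that u U_st st_sym by blast
  then show "u \<in> C" by (simp add: adm_eq_cl cl_def)
qed

text \<open>A neighbour \<open>z\<close> of \<open>y\<close> has \<open>u\<close> in its star, so
  \<open>z\<close> lies in \<open>st(u) = st(x)\<close>, and then \<open>C_st\<close> puts all of
  \<open>C\<close> into the star of \<open>z\<close>.\<close>

lemma C_subset_adm: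
  assumes "u \<in> U" "u \<in> adm \<Gamma> y"
  shows "C \<subseteq> adm \<Gamma> y"
proof
  fix c assume c: "c \<in> C"
  have "c \<in> st \<Gamma> z" if "z \<in> lk \<Gamma> y" for z
  proof -
    have "u \<in> st \<Gamma> z" using assms(2) that by (simp add: adm_def)
    then have "z \<in> st \<Gamma> x" using st_sym U_st[OF assms(1)] by blast
    then show ?thesis using C_st c by blast
  qed
  then show "c \<in> adm \<Gamma> y" using c C_subset_V by (auto simp: adm_def)
qed

lemma us_V: "i < s \<Longrightarrow> us ! i \<in> V" "i < s \<Longrightarrow> us ! i \<in> U" "i < s \<Longrightarrow> us ! i \<in> C"
  using us U_subset_V U_subset_C by (auto simp flip: us(2))

lemma ws_V: "k < m \<Longrightarrow> ws ! k \<in> V" "k < m \<Longrightarrow> ws ! k \<in> C" "k < m \<Longrightarrow> ws ! k \<notin> U"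
  using ws nth_mem[of k ws] C_subset_V by auto

lemma sum_C: "(\<Sum>c\<in>C. f c) = (\<Sum>j<s. f (us ! j)) + (\<Sum>k<m. f (ws ! k))"
  for f :: "'a \<Rightarrow> int"
proof -
  have "C = set us \<union> set ws" "set us \<inter> set ws = {}" using us ws U_subset_C by auto
  then have "sum f C = sum f (set us) + sum f (set ws)" by (simp add: sum.union_disjoint)
  then show ?thesis
    using sum.reindex_bij_betw[OF bij_betw_nth[OF us(1) HOL.refl HOL.refl], of f]
      sum.reindex_bij_betw[OF bij_betw_nth[OF ws(1) HOL.refl HOL.refl], of f] by simp
qed

section \<open>Endomorphisms described by a block row of integers\<close>

text \<open>Invertibility is left out on purpose: every block row is then realised, and inverses can
  be found by matrix algebra. Values outside the carrier are unconstrained, so equality of such maps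
  is only ever tested on the carrier.\<close>

definition class_endo :: "(('a \<times> bool) list set \<Rightarrow> ('a \<times> bool) list set) set" where
  "class_endo = {\<phi> \<in> hom (raag \<Gamma>) (raag \<Gamma>).
    (\<forall>y \<in> V - U. \<phi> (gen \<Gamma> y) = gen \<Gamma> y) \<and> (\<forall>u \<in> U. \<phi> (gen \<Gamma> u) \<in> raag_sub \<Gamma> C)}"

text \<open>Row \<open>i\<close> holds coordinates of the image of the \<open>i\<close>-th class
  vertex. With images as rows, the matrix of \<phi> followed by \<psi> is the product in that same
  order.\<close>

definition amat :: "(('a \<times> bool) list set \<Rightarrow> ('a \<times> bool) list set) \<Rightarrow> int mat" where
  "amat \<phi> = mat s s (\<lambda>(i, j). expo (us ! j) (\<phi> (gen \<Gamma> (us ! i))))"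

definition bmat :: "(('a \<times> bool) list set \<Rightarrow> ('a \<times> bool) list set) \<Rightarrow> int mat" where
  "bmat \<phi> = mat s m (\<lambda>(i, k). expo (ws ! k) (\<phi> (gen \<Gamma> (us ! i))))"

lemma amat_carrier [simp]: "amat \<phi> \<in> carrier_mat s s" by (simp add: amat_def)

lemma bmat_carrier [simp]: "bmat \<phi> \<in> carrier_mat s m" by (simp add: bmat_def)

text \<open>An exponent composed with \<psi> is a homomorphism to the integers, so its value on an
  element of the subgroup of \<open>C\<close> is read off from the coordinates; on the vertices
  \<open>ws\<close> the map \<psi> is the identity.\<close>

lemma class_endo_expo:
  assumes "\<phi> \<in> class_endo" "\<psi> \<in> class_endo" "i < s"
  shows "expo v (\<psi> (\<phi> (gen \<Gamma> (us ! i)))) =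
    (\<Sum>j<s. amat \<phi> $$ (i, j) * expo v (\<psi> (gen \<Gamma> (us ! j)))) +
    (\<Sum>k<m. bmat \<phi> $$ (i, k) * expo v (gen \<Gamma> (ws ! k)))"
proof -
  have "expo v \<circ> \<psi> \<in> hom (raag \<Gamma>) integer_group"
    using assms(2) expo_hom by (auto simp: class_endo_def intro: Group.hom_compose)
  moreover have "\<phi> (gen \<Gamma> (us ! i)) \<in> raag_sub \<Gamma> C"
    using assms(1,3) us_V by (simp add: class_endo_def)
  ultimately have "(expo v \<circ> \<psi>) (\<phi> (gen \<Gamma> (us ! i)))
    = (\<Sum>c\<in>C. expo c (\<phi> (gen \<Gamma> (us ! i))) * (expo v \<circ> \<psi>) (gen \<Gamma> c))"
    by (rule hom_integer_expo[OF C_subset_V])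
  moreover have "\<psi> (gen \<Gamma> (ws ! k)) = gen \<Gamma> (ws ! k)" if "k < m" for k
    using assms(2) that ws_V by (simp add: class_endo_def)
  ultimately show ?thesis using assms(3) by (simp add: sum_C amat_def bmat_def)
qed

text \<open>These are the top blocks of the product of two matrices with rows \<open>(A | B)\<close>
  and \<open>(0 | 1)\<close>. The composite is specified only on the carrier, which covers both
  plain compositions and the restricted product in \<open>right_Aut\<close>.\<close>

lemma mat_compose:
  assumes "\<phi> \<in> class_endo" "\<psi> \<in> class_endo" "\<And>g. g \<in> carrier (raag \<Gamma>) \<Longrightarrow> \<chi> g = \<psi> (\<phi> g)"
  shows amat_compose: "amat \<chi> = amat \<phi> * amat \<psi>"
    and bmat_compose: "bmat \<chi> = amat \<phi> * bmat \<psi> + bmat \<phi>"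
proof -
  have \<chi>: "\<chi> (gen \<Gamma> (us ! i)) = \<psi> (\<phi> (gen \<Gamma> (us ! i)))" if "i < s" for i
    using assms(3) gen_closed us_V that by simp
  \<comment> \<open>This is the zero block: the second sum of \<open>class_endo_expo\<close> drops
    out at class coordinates.\<close>
  have "expo (us ! j) (gen \<Gamma> (ws ! k)) = 0" if "j < s" "k < m" for j k
    using that us_V(2)[of j] ws_V(1,3)[of k] by (auto simp: expo_gen)
  then show "amat \<chi> = amat \<phi> * amat \<psi>"
    by (intro eq_matI)
      (auto simp: amat_def[of \<chi>] \<chi> class_endo_expo[OF assms(1,2)] scalar_prod_def
        atLeast0LessThan amat_def[of \<psi>] amat_def[of \<phi>])
  \<comment> \<open>This is the identity block: at the coordinates \<open>ws\<close> the second sum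
    returns the entry of \<open>bmat\<close> itself.\<close>
  have "(\<Sum>k<m. bmat \<phi> $$ (i, k) * expo (ws ! l) (gen \<Gamma> (ws ! k))) = bmat \<phi> $$ (i, l)"
    if "l < m" for i l
  proof -
    have "(\<Sum>k<m. bmat \<phi> $$ (i, k) * expo (ws ! l) (gen \<Gamma> (ws ! k)))
      = (\<Sum>k<m. if k = l then bmat \<phi> $$ (i, l) else 0)"
      using that ws_V(1) nth_eq_iff_index_eq[OF ws(1)] by (intro sum.cong) (auto simp: expo_gen)
    then show ?thesis using that by simp
  qed
  then have "bmat \<chi> $$ (i, l) = (amat \<phi> * bmat \<psi> + bmat \<phi>) $$ (i, l)" if "i < s" "l < m" for i l
    using that by (simp add: bmat_def[of \<chi>] \<chi> class_endo_expo[OF assms(1,2)] scalar_prod_def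
        atLeast0LessThan bmat_def[of \<psi>])
      (simp add: amat_def bmat_def scalar_prod_def atLeast0LessThan)
  then show "bmat \<chi> = amat \<phi> * bmat \<psi> + bmat \<phi>"
    by (intro eq_matI) (auto simp: amat_def bmat_def)
qed

lemma id_class_endo:
  assumes "\<And>g. g \<in> carrier (raag \<Gamma>) \<Longrightarrow> \<iota> g = g"
  shows "\<iota> \<in> class_endo" "amat \<iota> = 1\<^sub>m s" "bmat \<iota> = 0\<^sub>m s m"
proof -
  show "\<iota> \<in> class_endo"
    using assms gen_closed U_subset_V U_subset_C
    by (auto simp: class_endo_def hom_def gen_raag_sub subset_iff)
  show "amat \<iota> = 1\<^sub>m s"
    using assms gen_closed us_V(1) nth_eq_iff_index_eq[OF us(1)]
    by (intro eq_matI) (auto simp: amat_def expo_gen)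
  have "us ! i \<noteq> ws ! k" if "i < s" "k < m" for i k using that us_V(2) ws_V(3) by metis
  then show "bmat \<iota> = 0\<^sub>m s m"
    using assms gen_closed us_V(1) by (intro eq_matI) (auto simp: bmat_def expo_gen)
qed

text \<open>The two matrices list all exponents over \<open>C\<close> of the images of the class,
  and over the clique \<open>C\<close> exponents determine an element; all other generators are
  fixed.\<close>

lemma class_endo_eq:
  assumes "\<phi> \<in> class_endo" "\<psi> \<in> class_endo" "amat \<phi> = amat \<psi>" "bmat \<phi> = bmat \<psi>"
    and "g \<in> carrier (raag \<Gamma>)"
  shows "\<phi> g = \<psi> g"
proof (rule raag_hom_eq[OF is_group _ _ _ assms(5)])
  show "\<phi> \<in> hom (raag \<Gamma>) (raag \<Gamma>)" "\<psi> \<in> hom (raag \<Gamma>) (raag \<Gamma>)"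
    using assms by (simp_all add: class_endo_def)
  fix y assume y: "y \<in> V"
  show "\<phi> (gen \<Gamma> y) = \<psi> (gen \<Gamma> y)"
  proof (cases "y \<in> U")
    case False
    then show ?thesis using assms(1,2) y by (simp add: class_endo_def)
  next
    case True
    then obtain i where i: "i < s" "y = us ! i" using us(2) by (metis in_set_conv_nth)
    have "expo c (\<phi> (gen \<Gamma> y)) = expo c (\<psi> (gen \<Gamma> y))" if "c \<in> C" for c
    proof (cases "c \<in> U")
      case True
      then obtain j where j: "j < s" "c = us ! j" using us(2) by (metis in_set_conv_nth)
      have "amat \<phi> $$ (i, j) = amat \<psi> $$ (i, j)" using assms(3) by simp
      then show ?thesis using i j by (simp add: amat_def)
    next
      case False
      then have "c \<in> set ws" using that ws(2) by simp
      then obtain k where k: "k < m" "c = ws ! k" by (metis in_set_conv_nth)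
      have "bmat \<phi> $$ (i, k) = bmat \<psi> $$ (i, k)" using assms(4) by simp
      then show ?thesis using i k by (simp add: bmat_def)
    qed
    then show ?thesis
      using assms(1,2) True
      by (intro expo_inject[OF C_subset_V C_clique]) (auto simp: class_endo_def)
  qed
qed

lemma ex_class_endo:
  assumes "P \<in> carrier_mat s s" "Q \<in> carrier_mat s m"
  shows "\<exists>\<phi> \<in> class_endo. amat \<phi> = P \<and> bmat \<phi> = Q"
proof -
  have "\<exists>n. (\<forall>j<s. n (us ! j) = P $$ (i, j)) \<and> (\<forall>k<m. n (ws ! k) = Q $$ (i, k))" for i
  proof -
    \<comment> \<open>\<open>inv_into\<close> recovers the list index of a vertex, turning row
      \<open>i\<close> of the blocks into prescribed exponents on \<open>C\<close>.\<close>
    define n where "n c = (if c \<in> U then P $$ (i, inv_into {..<s} ((!) us) c)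
      else Q $$ (i, inv_into {..<m} ((!) ws) c))" for c
    have "inj_on ((!) us) {..<s}" "inj_on ((!) ws) {..<m}"
      using us(1) ws(1) by (auto intro: inj_on_nth)
    then show ?thesis using us_V(2) ws_V(3) by (intro exI[of _ n]) (auto simp: n_def)
  qed
  then obtain n where n: "\<And>i j. j < s \<Longrightarrow> n i (us ! j) = P $$ (i, j)"
    "\<And>i k. k < m \<Longrightarrow> n i (ws ! k) = Q $$ (i, k)" by metis
  have "\<forall>i. \<exists>g \<in> raag_sub \<Gamma> C. \<forall>c \<in> C. expo c g = n i c"
    using ex_expo[OF C_subset_V] by blast
  then obtain g where g: "\<And>i. g i \<in> raag_sub \<Gamma> C" "\<And>i c. c \<in> C \<Longrightarrow> expo c (g i) = n i c" by metis
  define f where "f y = (if y \<in> U then g (inv_into {..<s} ((!) us) y) else gen \<Gamma> y)" for y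
  have f_U: "f y \<in> raag_sub \<Gamma> C" if "y \<in> U" for y using g that by (simp add: f_def)
  have f_us: "f (us ! i) = g i" if "i < s" for i
    using that us_V(2) inj_on_nth[OF us(1), of "{..<s}"] by (simp add: f_def)
  \<comment> \<open>A neighbour \<open>z\<close> of \<open>y\<close> lies in
    \<open>st(y) = st(x)\<close>, so every vertex of \<open>C\<close> is in the star of
    \<open>z\<close>, and the generator \<open>z\<close> commutes with any image chosen for
    \<open>y\<close>.\<close>
  have cross: "f y \<otimes>\<^bsub>raag \<Gamma>\<^esub> f z = f z \<otimes>\<^bsub>raag \<Gamma>\<^esub> f y"
    if yz: "(y, z) \<in> parcs \<Gamma>" and y: "y \<in> U" and z: "z \<notin> U" for y z
  proof -
    have zV: "z \<in> V" using arc_in_V[OF yz] by simp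
    have "z \<in> st \<Gamma> x" using U_st[OF y] yz by (auto simp: st_def lk_def)
    moreover have "f z \<in> raag_sub \<Gamma> {z}" using z by (simp add: f_def gen_raag_sub)
    ultimately show ?thesis
      using zV C_st f_U[OF y] by (intro raag_sub_commute[OF C_subset_V, of "{z}"]) auto
  qed
  have "f y \<otimes>\<^bsub>raag \<Gamma>\<^esub> f z = f z \<otimes>\<^bsub>raag \<Gamma>\<^esub> f y" if yz: "(y, z) \<in> parcs \<Gamma>" for y z
  proof -
    consider "y \<in> U" "z \<in> U" | "y \<in> U" "z \<notin> U" | "y \<notin> U" "z \<in> U" | "y \<notin> U" "z \<notin> U" by blast
    then show ?thesis
    proof cases
      case 1
      then show ?thesis
        using f_U C_clique by (intro raag_sub_commute[OF C_subset_V C_subset_V]) auto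
    next
      case 2
      then show ?thesis using cross yz by blast
    next
      case 3
      then show ?thesis using cross[OF arc_sym[OF yz]] by simp
    next
      case 4
      then show ?thesis using gen_commute[OF yz] by (simp add: f_def)
    qed
  qed
  moreover have "f ` V \<subseteq> carrier (raag \<Gamma>)"
    using f_U raag_sub_closed[OF C_subset_V] gen_closed by (auto simp: f_def)
  ultimately obtain \<phi> where \<phi>: "\<phi> \<in> hom (raag \<Gamma>) (raag \<Gamma>)" "\<forall>v \<in> V. \<phi> (gen \<Gamma> v) = f v"
    using raag_lift[OF is_group, of f] by blast
  have "\<phi> \<in> class_endo"
    using \<phi> f_U U_subset_V by (auto simp: class_endo_def f_def)
  moreover have "amat \<phi> = P"
    using \<phi>(2) assms(1) us_V by (intro eq_matI) (auto simp: amat_def f_us g n)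
  moreover have "bmat \<phi> = Q"
    using \<phi>(2) assms(2) us_V ws_V by (intro eq_matI) (auto simp: bmat_def f_us g n)
  ultimately show ?thesis by blast
qed

text \<open>It suffices to look at generators: a fixed one stays, and a moved one lands in the
  subgroup of \<open>C\<close>, which is contained in the given subgroup by
  \<open>C_subset_adm\<close>.\<close>

lemma class_endo_stable:
  assumes "\<phi> \<in> class_endo"
  shows "\<phi> ` raag_sub \<Gamma> (adm \<Gamma> y) \<subseteq> raag_sub \<Gamma> (adm \<Gamma> y)"
proof -
  have V: "adm \<Gamma> y \<subseteq> V" by (auto simp: adm_def)
  interpret \<phi>: group_hom "raag \<Gamma>" "raag \<Gamma>" \<phi>
    using assms by (simp add: class_endo_def group_hom_def group_hom_axioms_def is_group)
  have "\<phi> (gen \<Gamma> z) \<in> raag_sub \<Gamma> (adm \<Gamma> y)" if z: "z \<in> adm \<Gamma> y" for z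
  proof (cases "z \<in> U")
    case True
    then have "\<phi> (gen \<Gamma> z) \<in> raag_sub \<Gamma> C" using assms by (simp add: class_endo_def)
    then show ?thesis using raag_sub_mono[OF C_subset_adm[OF True z]] by (rule rev_subsetD)
  next
    case False
    then show ?thesis using assms z V gen_raag_sub by (auto simp: class_endo_def)
  qed
  then have "generate (raag \<Gamma>) (\<phi> ` gen \<Gamma> ` adm \<Gamma> y) \<subseteq> raag_sub \<Gamma> (adm \<Gamma> y)"
    using raag_sub_subgroup[OF V] by (intro generate_subgroup_incl) auto
  then show ?thesis
    using \<phi>.generate_img[OF gen_image_closed[OF V]] by (simp add: raag_sub_def)
qed

lemma class_endo_inverse:
  assumes "\<phi> \<in> class_endo" "amat \<phi> \<in> carrier (GL_int s)"
  shows "\<exists>\<psi> \<in> class_endo. \<forall>g \<in> carrier (raag \<Gamma>). \<psi> (\<phi> g) = g \<and> \<phi> (\<psi> g) = g"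
proof -
  obtain P where P: "P \<in> carrier_mat s s" "P * amat \<phi> = 1\<^sub>m s" "amat \<phi> * P = 1\<^sub>m s"
    using assms(2) by (auto simp: GL_int_simps)
  have PB: "P * bmat \<phi> \<in> carrier_mat s m" using P by simp
  \<comment> \<open>The inverse of the block matrix with rows \<open>(A | B)\<close> and
    \<open>(0 | 1)\<close> has top row \<open>(P | -PB)\<close>, where \<open>P\<close> is the
    inverse of \<open>A\<close>.\<close>
  obtain \<psi> where \<psi>: "\<psi> \<in> class_endo" "amat \<psi> = P" "bmat \<psi> = - (P * bmat \<phi>)"
    using ex_class_endo[OF P(1), of "- (P * bmat \<phi>)"] PB by auto
  \<comment> \<open>Closure under composition needs the second map to preserve the subgroup of
    \<open>C\<close>, which is stability for \<open>adm\<close> of \<open>x\<close>.\<close>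
  have comp: "(\<lambda>g. \<beta> (\<alpha> g)) \<in> class_endo" if "\<alpha> \<in> class_endo" "\<beta> \<in> class_endo" for \<alpha> \<beta>
  proof -
    have "\<beta> \<circ> \<alpha> \<in> hom (raag \<Gamma>) (raag \<Gamma>)"
      using that by (auto simp: class_endo_def intro: Group.hom_compose)
    moreover have "\<beta> (\<alpha> (gen \<Gamma> u)) \<in> raag_sub \<Gamma> C" if "u \<in> U" for u
      using class_endo_stable[OF \<open>\<beta> \<in> class_endo\<close>, of x] \<open>\<alpha> \<in> class_endo\<close> that
      by (auto simp: class_endo_def)
    ultimately show ?thesis using that by (auto simp: class_endo_def comp_def)
  qed
  have "dim_col (amat \<phi>) = dim_row (P * bmat \<phi>)" using P(1) by (simp add: amat_def)
  from uminus_mult_right_mat[OF this] have "amat \<phi> * - (P * bmat \<phi>) = - ((amat \<phi> * P) * bmat \<phi>)"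
    by (simp only: assoc_mult_mat[OF amat_carrier P(1) bmat_carrier])
  \<comment> \<open>The off-diagonal block of \<phi> followed by \<psi> vanishes; the other order is
    treated below, and both composites then have the matrices of the identity.\<close>
  then have "amat \<phi> * bmat \<psi> + bmat \<phi> = 0\<^sub>m s m"
    using P \<psi>
    by (simp add: left_mult_one_mat[OF bmat_carrier] uminus_l_inv_mat[OF bmat_carrier])
  then have "\<psi> (\<phi> g) = g" if "g \<in> carrier (raag \<Gamma>)" for g
    using that P \<psi> id_class_endo[of "\<lambda>g. g"] mat_compose[OF assms(1) \<psi>(1), of "\<lambda>g. \<psi> (\<phi> g)"]
    by (intro class_endo_eq[OF comp[OF assms(1) \<psi>(1)], of "\<lambda>g. g"]) auto
  moreover have "P * bmat \<phi> + bmat \<psi> = 0\<^sub>m s m"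
    using PB \<psi> uminus_l_inv_mat[of "- (P * bmat \<phi>)" s m] by simp
  then have "\<phi> (\<psi> g) = g" if "g \<in> carrier (raag \<Gamma>)" for g
    using that P \<psi> id_class_endo[of "\<lambda>g. g"] mat_compose[OF \<psi>(1) assms(1), of "\<lambda>g. \<phi> (\<psi> g)"]
    by (intro class_endo_eq[OF comp[OF \<psi>(1) assms(1)], of "\<lambda>g. g"]) auto
  ultimately show ?thesis using \<psi>(1) by blast
qed

section \<open>The stabiliser as the invertible block rows\<close>

text \<open>The set \<open>C\<close> is itself a member of the family that must be preserved, and it
  contains the class.\<close>

lemma St_v_class_endo:
  assumes "\<phi> \<in> St_v \<Gamma> x"
  shows "\<phi> \<in> class_endo"
proof -
  have "\<phi> ` raag_sub \<Gamma> C = raag_sub \<Gamma> C" using assms x by (simp add: St_v_def St_K_def)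
  then have "\<phi> (gen \<Gamma> u) \<in> raag_sub \<Gamma> C" if "u \<in> U" for u
    using that U_subset_C gen_raag_sub by blast
  moreover have "\<phi> \<in> hom (raag \<Gamma>) (raag \<Gamma>)"
    using assms by (simp add: St_v_def St_K_def right_Aut_simps auto_def)
  ultimately show ?thesis using assms by (auto simp: class_endo_def St_v_def)
qed

text \<open>Restriction makes the map extensional, as \<open>Bij\<close> demands. The subgroups are
  preserved with equality because the inverse from \<open>class_endo_inverse\<close> is also a class
  endomorphism and hence also maps them into themselves.\<close>

lemma class_endo_St_v:
  assumes "\<phi> \<in> class_endo" "amat \<phi> \<in> carrier (GL_int s)"
  shows "restrict \<phi> (carrier (raag \<Gamma>)) \<in> St_v \<Gamma> x"
proof -
  obtain \<psi> where \<psi>: "\<psi> \<in> class_endo"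
    and inv: "\<forall>g \<in> carrier (raag \<Gamma>). \<psi> (\<phi> g) = g \<and> \<phi> (\<psi> g) = g"
    using class_endo_inverse[OF assms] by (rule bexE)
  have hom: "\<phi> \<in> hom (raag \<Gamma>) (raag \<Gamma>)" "\<psi> \<in> hom (raag \<Gamma>) (raag \<Gamma>)"
    using assms \<psi> by (simp_all add: class_endo_def)
  have "bij_betw \<phi> (carrier (raag \<Gamma>)) (carrier (raag \<Gamma>))"
    using inv hom by (intro bij_betw_byWitness[where f' = \<psi>]) (auto simp: hom_def)
  then have "restrict \<phi> (carrier (raag \<Gamma>)) \<in> Bij (carrier (raag \<Gamma>))"
    by (simp add: Bij_def bij_betw_restrict_eq)
  moreover have "restrict \<phi> (carrier (raag \<Gamma>)) \<in> hom (raag \<Gamma>) (raag \<Gamma>)"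
    using hom(1) by (auto simp: hom_def)
  moreover have "restrict \<phi> (carrier (raag \<Gamma>)) ` raag_sub \<Gamma> (adm \<Gamma> y) = raag_sub \<Gamma> (adm \<Gamma> y)" for y
  proof -
    have sub: "raag_sub \<Gamma> (adm \<Gamma> y) \<subseteq> carrier (raag \<Gamma>)"
      using raag_sub_closed[of "adm \<Gamma> y"] by (auto simp: adm_def)
    have "g \<in> \<phi> ` raag_sub \<Gamma> (adm \<Gamma> y)" if "g \<in> raag_sub \<Gamma> (adm \<Gamma> y)" for g
    proof (rule image_eqI)
      show "g = \<phi> (\<psi> g)" using inv subsetD[OF sub that] by simp
      show "\<psi> g \<in> raag_sub \<Gamma> (adm \<Gamma> y)" using subsetD[OF class_endo_stable[OF \<psi>] imageI[OF that]] .
    qed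
    then have "\<phi> ` raag_sub \<Gamma> (adm \<Gamma> y) = raag_sub \<Gamma> (adm \<Gamma> y)"
      by (intro equalityI class_endo_stable[OF assms(1)] subsetI)
    moreover have "restrict \<phi> (carrier (raag \<Gamma>)) ` raag_sub \<Gamma> (adm \<Gamma> y) = \<phi> ` raag_sub \<Gamma> (adm \<Gamma> y)"
      using subsetD[OF sub] by (intro image_cong) simp_all
    ultimately show ?thesis by simp
  qed
  moreover have "restrict \<phi> (carrier (raag \<Gamma>)) (gen \<Gamma> y) = gen \<Gamma> y" if "y \<in> V - U" for y
    using that assms(1) gen_closed by (simp add: class_endo_def)
  ultimately show ?thesis by (simp add: St_v_def St_K_def right_Aut_simps auto_def)
qed

lemma St_v_compose:
  assumes "\<phi> \<in> St_v \<Gamma> x" "\<psi> \<in> St_v \<Gamma> x" "g \<in> carrier (raag \<Gamma>)"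
  shows "(\<phi> \<otimes>\<^bsub>right_Aut (raag \<Gamma>)\<^esub> \<psi>) g = \<psi> (\<phi> g)"
  using assms by (simp add: St_v_def St_K_def right_Aut_simps compose_eq)

text \<open>The inverse automorphism again lies in the stabiliser, so its matrix is defined, and
  multiplicativity in both orders makes it a two-sided inverse over the integers.\<close>

lemma St_v_amat:
  assumes "\<phi> \<in> St_v \<Gamma> x"
  shows "amat \<phi> \<in> carrier (GL_int s)"
proof -
  interpret A: group "right_Aut (raag \<Gamma>)" by (rule group_right_Aut)
  interpret S: subgroup "St_v \<Gamma> x" "right_Aut (raag \<Gamma>)" by (rule subgroup_St_v)
  define \<psi> where "\<psi> = inv\<^bsub>right_Aut (raag \<Gamma>)\<^esub> \<phi>"
  have \<psi>: "\<psi> \<in> St_v \<Gamma> x" using assms by (simp add: \<psi>_def)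
  note endo = St_v_class_endo[OF assms] St_v_class_endo[OF \<psi>]
  have one: "amat \<one>\<^bsub>right_Aut (raag \<Gamma>)\<^esub> = 1\<^sub>m s"
    by (rule id_class_endo) (simp add: right_Aut_simps)
  have "amat (\<phi> \<otimes>\<^bsub>right_Aut (raag \<Gamma>)\<^esub> \<psi>) = amat \<phi> * amat \<psi>"
    using St_v_compose[OF assms \<psi>] by (rule amat_compose[OF endo])
  moreover have "amat (\<psi> \<otimes>\<^bsub>right_Aut (raag \<Gamma>)\<^esub> \<phi>) = amat \<psi> * amat \<phi>"
    using St_v_compose[OF \<psi> assms] by (rule amat_compose[OF endo(2,1)])
  moreover have "\<phi> \<otimes>\<^bsub>right_Aut (raag \<Gamma>)\<^esub> \<psi> = \<one>\<^bsub>right_Aut (raag \<Gamma>)\<^esub>"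
    "\<psi> \<otimes>\<^bsub>right_Aut (raag \<Gamma>)\<^esub> \<phi> = \<one>\<^bsub>right_Aut (raag \<Gamma>)\<^esub>"
    using assms by (simp_all add: \<psi>_def)
  ultimately show ?thesis
    unfolding GL_int_simps(3) using one by (intro conjI bexI[of _ "amat \<psi>"]) auto
qed

text \<open>In \<^const>\<open>semidirect\<close> the pair \<open>(A, N)\<close> is the product of the block-diagonal automorphism of \<open>A\<close>
  with the unipotent one of \<open>N\<close>, which has upper right block \<open>A * N\<close>; hence the factor \<open>A\<inverse>\<close>.\<close>

definition St_v_map :: "(('a \<times> bool) list set \<Rightarrow> ('a \<times> bool) list set) \<Rightarrow> int mat \<times> int mat" where
  "St_v_map \<phi> = (amat \<phi>, inv\<^bsub>GL_int s\<^esub> (amat \<phi>) * bmat \<phi>)"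

lemma St_v_map_iso: "St_v_map \<in> iso (St_v_group \<Gamma> x) (semidirect (GL_int s) (GL_action s m) (M_int s m))"
proof -
  let ?S = "semidirect (GL_int s) (GL_action s m) (M_int s m)"
  have S: "carrier ?S = carrier (GL_int s) \<times> carrier_mat s m"
    by (simp add: semidirect_def M_int_simps)
  have closed: "St_v_map \<phi> \<in> carrier ?S" if "\<phi> \<in> St_v \<Gamma> x" for \<phi>
    using St_v_amat[OF that] GL_int_inv(2)[OF St_v_amat[OF that]] by (simp add: S St_v_map_def)
  have mult: "St_v_map (\<phi> \<otimes>\<^bsub>right_Aut (raag \<Gamma>)\<^esub> \<psi>) = St_v_map \<phi> \<otimes>\<^bsub>?S\<^esub> St_v_map \<psi>"
    if \<phi>: "\<phi> \<in> St_v \<Gamma> x" and \<psi>: "\<psi> \<in> St_v \<Gamma> x" for \<phi> \<psi>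
  proof -
    note a = St_v_amat[OF \<phi>] St_v_amat[OF \<psi>]
    let ?I = "inv\<^bsub>GL_int s\<^esub> (amat \<phi>)" and ?J = "inv\<^bsub>GL_int s\<^esub> (amat \<psi>)"
    have I: "?I \<in> carrier_mat s s" "?J \<in> carrier_mat s s" "?I * amat \<phi> = 1\<^sub>m s"
      using a by (simp_all add: GL_int_inv)
    note comp = mat_compose[OF St_v_class_endo[OF \<phi>] St_v_class_endo[OF \<psi>] St_v_compose[OF \<phi> \<psi>]]
    \<comment> \<open>Normalising the off-diagonal block of the composite by the inverse of the
      whole diagonal block gives \<open>?J\<close> applied to the normalised block of \<phi>, plus
      the normalised block of \<psi>: the second component of the semidirect product.\<close>
    have "(?J * ?I) * (amat \<phi> * bmat \<psi> + bmat \<phi>) = ?J * (?I * (amat \<phi> * bmat \<psi> + bmat \<phi>))"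
      using I by (intro assoc_mult_mat[of _ s s _ s _ m]) auto
    also have "?I * (amat \<phi> * bmat \<psi> + bmat \<phi>) = ?I * (amat \<phi> * bmat \<psi>) + ?I * bmat \<phi>"
      using I mult_carrier_mat[OF amat_carrier bmat_carrier]
      by (intro mult_add_distrib_mat[of _ s s _ m]) auto
    also have "?I * (amat \<phi> * bmat \<psi>) = bmat \<psi>"
      using I by (simp add: left_mult_one_mat[OF bmat_carrier]
          flip: assoc_mult_mat[OF I(1) amat_carrier bmat_carrier])
    also have "?J * (bmat \<psi> + ?I * bmat \<phi>) = ?J * bmat \<psi> + ?J * (?I * bmat \<phi>)"
      using I by (intro mult_add_distrib_mat[of _ s s _ m]) auto
    also have "\<dots> = ?J * (?I * bmat \<phi>) + ?J * bmat \<psi>"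
      using I by (intro comm_add_mat[of _ s m]) auto
    finally show ?thesis
      using a I by (simp add: St_v_map_def comp GL_int_inv_mult semidirect_def GL_int_simps(1)
          M_int_simps GL_action_def)
  qed
  have "inj_on St_v_map (St_v \<Gamma> x)"
  proof (rule inj_onI)
    fix \<phi> \<psi> assume \<phi>: "\<phi> \<in> St_v \<Gamma> x" and \<psi>: "\<psi> \<in> St_v \<Gamma> x" and eq: "St_v_map \<phi> = St_v_map \<psi>"
    have amat: "amat \<phi> = amat \<psi>" using eq by (simp add: St_v_map_def)
    note I = GL_int_inv[OF St_v_amat[OF \<psi>]]
    \<comment> \<open>Multiplying the second component by the diagonal block recovers
      \<open>bmat\<close>, so the pair loses no information.\<close>
    have rec: "amat \<psi> * (inv\<^bsub>GL_int s\<^esub> (amat \<psi>) * bmat \<chi>) = bmat \<chi>" for \<chi>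
      using I by (simp add: left_mult_one_mat[OF bmat_carrier]
          flip: assoc_mult_mat[OF amat_carrier I(2) bmat_carrier])
    have "inv\<^bsub>GL_int s\<^esub> (amat \<psi>) * bmat \<phi> = inv\<^bsub>GL_int s\<^esub> (amat \<psi>) * bmat \<psi>"
      using eq unfolding St_v_map_def amat by (rule Pair_inject)
    from arg_cong[OF this, of "(*) (amat \<psi>)"] have "bmat \<phi> = bmat \<psi>" by (simp only: rec)
    note class_endo_eq[OF St_v_class_endo[OF \<phi>] St_v_class_endo[OF \<psi>] amat this]
    \<comment> \<open>Agreement on the carrier becomes equality of functions, since automorphisms
      are extensional.\<close>
    moreover have "\<phi> \<in> extensional (carrier (raag \<Gamma>))" "\<psi> \<in> extensional (carrier (raag \<Gamma>))"
      using \<phi> \<psi> by (auto simp: St_v_def St_K_def right_Aut_simps auto_def Bij_def)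
    ultimately show "\<phi> = \<psi>" by (blast intro: extensionalityI)
  qed
  moreover have "St_v_map ` St_v \<Gamma> x = carrier ?S"
  proof
    show "St_v_map ` St_v \<Gamma> x \<subseteq> carrier ?S" using closed by blast
    show "carrier ?S \<subseteq> St_v_map ` St_v \<Gamma> x"
    proof
      fix p assume "p \<in> carrier ?S"
      then obtain P Q where p: "p = (P, Q)" and P: "P \<in> carrier (GL_int s)" and Q: "Q \<in> carrier_mat s m"
        by (auto simp: S)
      have P': "P \<in> carrier_mat s s" using P by (simp add: GL_int_simps)
      \<comment> \<open>The block \<open>P * Q\<close> is chosen so that normalising by the inverse
        of \<open>P\<close> leaves \<open>Q\<close>.\<close>
      obtain \<phi> where \<phi>: "\<phi> \<in> class_endo" "amat \<phi> = P" "bmat \<phi> = P * Q"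
        using ex_class_endo[OF P', of "P * Q"] P' Q by auto
      let ?\<phi> = "restrict \<phi> (carrier (raag \<Gamma>))"
      have "amat ?\<phi> = amat \<phi>" "bmat ?\<phi> = bmat \<phi>"
        using gen_closed us_V(1) by (auto simp: amat_def bmat_def intro!: cong_mat)
      moreover have "inv\<^bsub>GL_int s\<^esub> P * (P * Q) = Q"
        using Q GL_int_inv(3)[OF P] by (simp flip: assoc_mult_mat[OF GL_int_inv(2)[OF P] P' Q])
      ultimately have "St_v_map ?\<phi> = p" using \<phi> p by (simp add: St_v_map_def)
      moreover have "?\<phi> \<in> St_v \<Gamma> x" using class_endo_St_v[OF \<phi>(1)] P \<phi>(2) by simp
      ultimately show "p \<in> St_v_map ` St_v \<Gamma> x" by blast
    qed
  qed
  ultimately show ?thesis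
    using closed mult by (intro isoI homI) (simp_all add: St_v_group_def bij_betw_def)
qed

end

theorem theorem1p2:
  fixes \<Gamma> :: "'a pair_pre_digraph" and x :: 'a and r s :: nat
  assumes "pair_graph \<Gamma>"
    and "x \<in> pverts \<Gamma>"
    and "adm \<Gamma> x = cl \<Gamma> x"
    and "card (adm \<Gamma> x) = r"
    and "card (nbh_class \<Gamma> x) = s"
  shows "s \<le> r \<and>
    GL_action s (r - s) \<in> hom (GL_int s) (right_Aut (M_int s (r - s))) \<and>
    St_v_group \<Gamma> x \<cong> semidirect (GL_int s) (GL_action s (r - s)) (M_int s (r - s))"
proof -
  interpret simple_graph \<Gamma> by (rule simple_graph.intro) (rule assms(1))
  have fin: "finite (nbh_class \<Gamma> x)" "finite (adm \<Gamma> x)"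
    using finite_V by (auto simp: nbh_class_def adm_def)
  obtain us where us: "distinct us" "set us = nbh_class \<Gamma> x"
    using finite_distinct_list[OF fin(1)] by blast
  obtain ws where ws: "distinct ws" "set ws = adm \<Gamma> x - nbh_class \<Gamma> x"
    using finite_distinct_list[of "adm \<Gamma> x - nbh_class \<Gamma> x"] fin by blast
  interpret cv: clique_vertex \<Gamma> x us ws using assms(2,3) us ws by unfold_locales
  \<comment> \<open>The inclusion of the class in \<open>C\<close> makes \<open>r - s\<close> the
    true number of remaining vertices.\<close>
  have "length us = s" "length ws = r - s"
    using us ws assms(4,5) card_Diff_subset[OF fin(1) cv.U_subset_C]
    by (simp_all flip: distinct_card)
  moreover have "s \<le> r" using card_mono[OF fin(2) cv.U_subset_C] assms(4,5) by simp
  ultimately show ?thesis using cv.St_v_map_iso GL_action_hom by (auto intro: is_isoI)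
qed

end
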